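(* Let $K$ be a field and let $f_1,\dots,f_n\in K[t_1,\dots,t_s]\setminus K$ be such that the ideal $\mathrm{Implicit}(f_1,\dots,f_n)\subseteq K[x_1,\dots,x_n]$ is principal and non-zero. Then the algorithm ElimTH (described in the context), applied to $f_1,\dots,f_n$, terminates, and its output $g_{\mathrm{calc}}\in K[x_1,\dots,x_n]$ generates $\mathrm{Implicit}(f_1,\dots,f_n)$.
   Context: $\mathrm{Implicit}(f_1,\dots,f_n)$ denotes the kernel of the $K$-algebra homomorphism $K[x_1,\dots,x_n]\to K[t_1,\dots,t_s]$ sending $x_i\mapsto f_i$. $\mathrm{LT}_\sigma(G)$ denotes the leading power-product of $G$ with respect to a term-ordering $\sigma$. Algorithm ElimTH: Step 1 (initialization). Form the polynomial ring $R=K[t_1,\dots,t_s,h,x_1,\dots,x_n]$ graded by $\deg(t_j)=\deg(h)=1$ and $\deg(x_i)=\deg(f_i)$ (total degree of $f_i$). Let $\sigma$ be an elimination ordering for $\{t_1,\dots,t_s\}$ on $R$, i.e. a term-ordering such that any polynomial whose $\sigma$-leading power-product involves no $t_j$ lies in $K[h,x_1,\dots,x_n]$. Let $F_i=f_i^{\mathrm{hom}(h)}\in R$ be the usual homogenization of $f_i$ with respect to $h$, and let $J=\langle x_1-F_1,\dots,x_n-F_n\rangle\subseteq R$ (a homogeneous ideal for the grading). Step 2 (main loop). Run Buchberger's algorithm for computing a $\sigma$-Gröbner basis $GB$ of $J$, starting from the generators $x_i-F_i$, degree by degree: always process a critical pair of lowest degree (in the grading of $R$ given by $\deg(t_j)=\deg(h)=1$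 for $j=1,\dots,s$ and $\deg(x_i)=\deg(f_i)$ for $i=1,\dots,n$), reduce its S-polynomial with respect to the current $GB$, and, if the result is non-zero, add it to $GB$ together with the corresponding new pairs. As soon as a polynomial $G$ such that $\mathrm{LT}_\sigma(G)$ is not divisible by any $t_j$ is added to $GB$, exit the loop. Step 3. Let $g_{\mathrm{calc}}\in K[x_1,\dots,x_n]$ be the polynomial obtained from this $G$ by setting $h=1$. Output $g_{\mathrm{calc}}$. *)

theory Defs
  imports Complex_Main "HOL-Library.Poly_Mapping"
begin

text \<open>
  Power-products in the variables \<open>'v\<close> are finitely supported exponent functions, written
  additively; polynomials are finitely supported coefficient functions on power-products.
  The ring structure is the convolution product of \<open>Poly_Mapping\<close>.
\<close>

type_synonym 'v pp = "'v \<Rightarrow>\<^sub>0 nat"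
type_synonym ('v, 'a) mpoly = "('v \<Rightarrow>\<^sub>0 nat) \<Rightarrow>\<^sub>0 'a"


subsection \<open>Polynomials, substitution, ideals\<close>

definition Const :: "'a::comm_ring_1 \<Rightarrow> ('v, 'a) mpoly" where
  "Const c = Poly_Mapping.single 0 c"

definition Var :: "'v \<Rightarrow> ('v, 'a::comm_ring_1) mpoly" where
  "Var v = Poly_Mapping.single (Poly_Mapping.single v 1) 1"

definition vars :: "('v, 'a::zero) mpoly \<Rightarrow> 'v set" where
  "vars p = (\<Union>m\<in>Poly_Mapping.keys p. Poly_Mapping.keys m)"

definition pp_eval :: "('v \<Rightarrow> 'b::comm_ring_1) \<Rightarrow> 'v pp \<Rightarrow> 'b" where
  "pp_eval \<phi> m = (\<Prod>v\<in>Poly_Mapping.keys m. \<phi> v ^ Poly_Mapping.lookup m v)"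

text \<open>The \<open>K\<close>-algebra homomorphism sending each variable \<open>v\<close> to \<open>\<phi> v\<close>.\<close>

definition subst ::
  "('v \<Rightarrow> ('w, 'a) mpoly) \<Rightarrow> ('v, 'a::comm_ring_1) mpoly \<Rightarrow> ('w, 'a) mpoly" where
  "subst \<phi> p =
    (\<Sum>m\<in>Poly_Mapping.keys p. Const (Poly_Mapping.lookup p m) * pp_eval \<phi> m)"

definition Implicit :: "('n \<Rightarrow> ('s, 'a::comm_ring_1) mpoly) \<Rightarrow> ('n, 'a) mpoly set" where
  "Implicit f = {p. subst f p = 0}"

text \<open>A commutative ring as a module over itself: \<open>ideal.span B\<close> is the ideal generated by \<open>B\<close>.\<close>

interpretation ideal: module "(*) :: 'r::comm_ring_1 \<Rightarrow> 'r \<Rightarrow> 'r"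
  by standard (simp_all add: algebra_simps)


subsection \<open>Degrees and homogenization\<close>

definition wdeg :: "('v \<Rightarrow> nat) \<Rightarrow> 'v pp \<Rightarrow> nat" where
  "wdeg w m = (\<Sum>v\<in>Poly_Mapping.keys m. w v * Poly_Mapping.lookup m v)"

definition total_degree :: "('v, 'a::zero) mpoly \<Rightarrow> nat" where
  "total_degree p = Max (insert 0 (wdeg (\<lambda>_. 1) ` Poly_Mapping.keys p))"

datatype ('s, 'n) var = T 's | H | X 'n

text \<open>\<open>('s, 'n) var\<close> are the variables of \<open>R = K[t, h, x]\<close>.\<close>

definition homogenization :: "('s, 'a::comm_ring_1) mpoly \<Rightarrow> (('s, 'n) var, 'a) mpoly" where
  "homogenization p =
    (\<Sum>m\<in>Poly_Mapping.keys p. Const (Poly_Mapping.lookup p m)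
        * pp_eval (\<lambda>j. Var (T j)) m * Var H ^ (total_degree p - wdeg (\<lambda>_. 1) m))"

fun grading :: "('n \<Rightarrow> ('s, 'a::zero) mpoly) \<Rightarrow> ('s, 'n) var \<Rightarrow> nat" where
  "grading f (T j) = 1"
| "grading f H = 1"
| "grading f (X i) = total_degree (f i)"


subsection \<open>Term-orderings\<close>

text \<open>\<open>(s, t) \<in> \<sigma>\<close> means that \<open>s\<close> is at most \<open>t\<close>.\<close>

definition term_ordering :: "'v pp rel \<Rightarrow> bool" where
  "term_ordering \<sigma> \<longleftrightarrow> linear_order \<sigma> \<and> (\<forall>t. (0, t) \<in> \<sigma>) \<and>
     (\<forall>s t u. (s, t) \<in> \<sigma> \<longrightarrow> (s + u, t + u) \<in> \<sigma>)"

text \<open>Only meaningful for nonzero polynomials.\<close>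

definition LT :: "'v pp rel \<Rightarrow> ('v, 'a::zero) mpoly \<Rightarrow> 'v pp" where
  "LT \<sigma> p = (THE m. m \<in> Poly_Mapping.keys p \<and> (\<forall>m'\<in>Poly_Mapping.keys p. (m', m) \<in> \<sigma>))"

definition LC :: "'v pp rel \<Rightarrow> ('v, 'a::zero) mpoly \<Rightarrow> 'a" where
  "LC \<sigma> p = Poly_Mapping.lookup p (LT \<sigma> p)"

text \<open>The type argument supplies the coefficient field of the polynomials quantified over.\<close>

definition elimination_ordering :: "'a::zero itself \<Rightarrow> 'v set \<Rightarrow> 'v pp rel \<Rightarrow> bool" where
  "elimination_ordering K Y \<sigma> \<longleftrightarrow> term_ordering \<sigma> \<and>
     (\<forall>p :: ('v, 'a) mpoly. p \<noteq> 0 \<longrightarrow>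
        Poly_Mapping.keys (LT \<sigma> p) \<inter> Y = {} \<longrightarrow> vars p \<inter> Y = {})"


subsection \<open>S-polynomials and reduction\<close>

text \<open>Subtraction of exponents is truncated, so the exponents below are pointwise maxima.\<close>

definition pp_lcm :: "'v pp \<Rightarrow> 'v pp \<Rightarrow> 'v pp" where
  "pp_lcm s t = s + (t - s)"

definition pp_dvd :: "'v pp \<Rightarrow> 'v pp \<Rightarrow> bool" where
  "pp_dvd s t \<longleftrightarrow> (\<exists>u. t = s + u)"

definition spoly ::
  "'v pp rel \<Rightarrow> ('v, 'a::field) mpoly \<Rightarrow> ('v, 'a) mpoly \<Rightarrow> ('v, 'a) mpoly" where
  "spoly \<sigma> p q = (let l = pp_lcm (LT \<sigma> p) (LT \<sigma> q) in
     Poly_Mapping.single (l - LT \<sigma> p) (1 / LC \<sigma> p) * p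
     - Poly_Mapping.single (l - LT \<sigma> q) (1 / LC \<sigma> q) * q)"

text \<open>One step of the division algorithm; the term reduced need not be the leading one.\<close>

definition red ::
  "'v pp rel \<Rightarrow> ('v, 'a::field) mpoly set \<Rightarrow> ('v, 'a) mpoly \<Rightarrow> ('v, 'a) mpoly \<Rightarrow> bool" where
  "red \<sigma> B p q \<longleftrightarrow> (\<exists>b\<in>B. \<exists>m\<in>Poly_Mapping.keys p. b \<noteq> 0 \<and> pp_dvd (LT \<sigma> b) m \<and>
     q = p - Poly_Mapping.single (m - LT \<sigma> b) (Poly_Mapping.lookup p m / LC \<sigma> b) * b)"


subsection \<open>The algorithm ElimTH\<close>

text \<open>
  The algorithm is a nondeterministic transition system: the order in which critical pairs of
  equal degree are processed, and the choice of reducers, are left open.  A critical pair is an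
  unordered pair, represented as a two-element set.

  \<^item> \<open>Loop GB P\<close>: current basis and pairs still to be processed;
  \<^item> \<open>Reduce GB P r\<close>: the S-polynomial of the selected pair has so far been reduced to \<open>r\<close>;
  \<^item> \<open>Exit G\<close>: the loop was left because of \<open>G\<close>.
\<close>

datatype 'r state = Loop "'r set" "'r set set" | Reduce "'r set" "'r set set" 'r | Exit 'r

definition generators ::
  "('n \<Rightarrow> ('s, 'a::comm_ring_1) mpoly) \<Rightarrow> (('s, 'n) var, 'a) mpoly set" where
  "generators f = range (\<lambda>i. Var (X i) - homogenization (f i))"

definition elimTH_init ::
  "('n \<Rightarrow> ('s, 'a::comm_ring_1) mpoly) \<Rightarrow> (('s, 'n) var, 'a) mpoly state" where
  "elimTH_init f =
     Loop (generators f) {{p, q} |p q. p \<in> generators f \<and> q \<in> generators f \<and> p \<noteq> q}"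

text \<open>
  For polynomials homogeneous with respect to \<open>w\<close>, this is the degree of their S-polynomial, if nonzero.
\<close>

definition pair_degree ::
  "('v \<Rightarrow> nat) \<Rightarrow> 'v pp rel \<Rightarrow> ('v, 'a::zero) mpoly \<Rightarrow> ('v, 'a) mpoly \<Rightarrow> nat" where
  "pair_degree w \<sigma> p q = wdeg w (pp_lcm (LT \<sigma> p) (LT \<sigma> q))"

inductive elimTH_step ::
  "('n \<Rightarrow> ('s, 'a::field) mpoly) \<Rightarrow> ('s, 'n) var pp rel \<Rightarrow>
   (('s, 'n) var, 'a) mpoly state \<Rightarrow> (('s, 'n) var, 'a) mpoly state \<Rightarrow> bool"
  for f :: "'n \<Rightarrow> ('s, 'a::field) mpoly" and \<sigma> :: "('s, 'n) var pp rel" where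
  select: "{p, q} \<in> P \<Longrightarrow>
     \<forall>p' q'. {p', q'} \<in> P \<longrightarrow>
       pair_degree (grading f) \<sigma> p q \<le> pair_degree (grading f) \<sigma> p' q' \<Longrightarrow>
     elimTH_step f \<sigma> (Loop GB P) (Reduce GB (P - {{p, q}}) (spoly \<sigma> p q))"
| reduce: "red \<sigma> GB r r' \<Longrightarrow> elimTH_step f \<sigma> (Reduce GB P r) (Reduce GB P r')"
| discard: "elimTH_step f \<sigma> (Reduce GB P 0) (Loop GB P)"
| add: "r \<noteq> 0 \<Longrightarrow> \<nexists>r'. red \<sigma> GB r r' \<Longrightarrow> Poly_Mapping.keys (LT \<sigma> r) \<inter> range T \<noteq> {} \<Longrightarrow>
     elimTH_step f \<sigma> (Reduce GB P r) (Loop (insert r GB) (P \<union> {{g, r} |g. g \<in> GB}))"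
| exit: "r \<noteq> 0 \<Longrightarrow> \<nexists>r'. red \<sigma> GB r r' \<Longrightarrow> Poly_Mapping.keys (LT \<sigma> r) \<inter> range T = {} \<Longrightarrow>
     elimTH_step f \<sigma> (Reduce GB P r) (Exit r)"

text \<open>
  \<open>g\<close>, viewed in \<open>R\<close>, is the result of setting \<open>h = 1\<close> in \<open>G\<close>.  For given \<open>G\<close> there is at
  most one such \<open>g\<close>, and there is one precisely if no \<open>t\<^sub>j\<close> survives in the result.
\<close>

definition elimTH_output :: "(('s, 'n) var, 'a::comm_ring_1) mpoly \<Rightarrow> ('n, 'a) mpoly \<Rightarrow> bool" where
  "elimTH_output G g \<longleftrightarrow>
     subst (\<lambda>i. Var (X i)) g = subst (\<lambda>v. if v = H then 1 else Var v) G"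

end

theory Submission
  imports Defs "HOL-Library.Multiset"
begin

text \<open>
  Write \<open>J\<close> for the ideal generated by the \<open>x\<^sub>i - F\<^sub>i\<close> and grade \<open>R\<close> as the algorithm does. Every
  polynomial that occurs is homogeneous, and \<open>J\<close> is the kernel of \<open>x\<^sub>i \<mapsto> F\<^sub>i\<close>. Since the \<open>F\<^sub>i\<close>
  become the \<open>f\<^sub>i\<close> at \<open>h = 1\<close>, dehomogenizing an element of \<open>J\<close> without \<open>t\<^sub>j\<close> yields an implicit
  relation, and homogenizing an implicit relation yields an element of \<open>J\<close> without \<open>t\<^sub>j\<close>.

  The point of the degree-by-degree strategy is that the polynomial \<open>G\<close> at which the loop is left
  has the least degree among all nonzero homogeneous elements of \<open>J\<close> with leading term free of
  the \<open>t\<^sub>j\<close>. For when the critical pair that leads to \<open>G\<close> is chosen, all pairs of smaller degree have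
  been treated. Buchberger's criterion holds degree by degree
  (\<open>truncated_buchberger_criterion\<close>), so in those degrees the leading term of every element
  of \<open>J\<close> is a multiple of a leading term of the basis, and these all contain some \<open>t\<^sub>j\<close>. This is
  what the predicate \<open>invariant\<close> records; it is kept by every step (\<open>invariant_step\<close>).

  Minimality forces the output \<open>g\<close> to be a generator (\<open>minimal_degree_generates\<close>): if \<open>g\<^sub>0\<close> generates
  the implicit ideal, then \<open>g = a * g\<^sub>0\<close>. The homogenization of \<open>g\<^sub>0\<close> competes with \<open>G\<close>, so the degree
  of \<open>g\<close> is at most that of \<open>g\<^sub>0\<close>; degrees are additive and all variables have positive degree, so
  \<open>a\<close> is a constant. The homogenization of \<open>g\<^sub>0\<close> also shows that the loop cannot run out of pairs
  (\<open>final_state\<close>), because the basis would then be a Groebner basis all of whose leading terms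
  contain some \<open>t\<^sub>j\<close>.

  Termination follows from Dickson's lemma, used twice: a term ordering is well-founded, so
  reductions end; and the ideal of leading monomials can grow only finitely often, so only
  finitely many polynomials are added (\<open>rank_decreases\<close>).
\<close>

section \<open>Polynomials and substitution\<close>

abbreviation keys where "keys \<equiv> Poly_Mapping.keys"
abbreviation lookup where "lookup \<equiv> Poly_Mapping.lookup"
abbreviation single where "single \<equiv> Poly_Mapping.single"

lemma sum_singles:
  fixes p :: "'k \<Rightarrow>\<^sub>0 'b::comm_monoid_add"
  shows "(\<Sum>m\<in>keys p. single m (lookup p m)) = p"
  by (rule poly_mapping_eqI)
    (simp add: lookup_sum lookup_single when_def in_keys_iff)

lemma mpoly_induct [case_names zero add]:
  fixes p :: "'k \<Rightarrow>\<^sub>0 'b::comm_monoid_add"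
  assumes "P 0" and "\<And>p m c. P p \<Longrightarrow> P (p + single m c)"
  shows "P p"
proof -
  have "P (\<Sum>m\<in>A. single m (lookup p m))" if "finite A" for A
    using that by (induction A) (simp_all add: assms add.commute[of "single _ _"])
  from this[of "keys p"] show ?thesis by (simp add: sum_singles)
qed

lemma pp_eval_superset:
  assumes "finite A" "keys m \<subseteq> A"
  shows "pp_eval \<phi> m = (\<Prod>v\<in>A. \<phi> v ^ lookup m v)"
  unfolding pp_eval_def
  by (rule prod.mono_neutral_left) (use assms in \<open>auto simp: in_keys_iff\<close>)

lemma pp_eval_add: "pp_eval \<phi> (m + m') = pp_eval \<phi> m * pp_eval \<phi> m'"
proof -
  let ?A = "keys m \<union> keys m'"
  have "pp_eval \<phi> n = (\<Prod>v\<in>?A. \<phi> v ^ lookup n v)" if "n \<in> {m, m', m + m'}" for n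
    by (rule pp_eval_superset) (use that keys_add[of m m'] in auto)
  then show ?thesis by (simp add: lookup_add power_add prod.distrib)
qed

lemma pp_eval_zero [simp]: "pp_eval \<phi> 0 = 1"
  by (simp add: pp_eval_def)

lemma pp_eval_single: "pp_eval \<phi> (single v k) = \<phi> v ^ k"
  by (simp add: pp_eval_def)

lemma pp_eval_cong: "(\<And>v. v \<in> keys m \<Longrightarrow> \<phi> v = \<psi> v) \<Longrightarrow> pp_eval \<phi> m = pp_eval \<psi> m"
  by (simp add: pp_eval_def)

lemma Const_zero [simp]: "Const 0 = 0"
  and Const_one [simp]: "Const 1 = 1"
  and Const_add: "Const (a + b) = Const a + Const b"
  and Const_mult: "Const (a * b) = Const a * Const b"
  by (simp_all add: Const_def single_add mult_single)

lemma Const_times_single: "Const a * single m b = single m (a * b)"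
  by (simp add: Const_def mult_single)

lemma subst_superset:
  assumes "finite A" "keys p \<subseteq> A"
  shows "subst \<phi> p = (\<Sum>m\<in>A. Const (lookup p m) * pp_eval \<phi> m)"
  unfolding subst_def
  by (rule sum.mono_neutral_left) (use assms in \<open>auto simp: in_keys_iff\<close>)

lemma subst_zero [simp]: "subst \<phi> 0 = 0"
  by (simp add: subst_def)

lemma subst_add: "subst \<phi> (p + q) = subst \<phi> p + subst \<phi> q"
proof -
  let ?A = "keys p \<union> keys q"
  have "subst \<phi> r = (\<Sum>m\<in>?A. Const (lookup r m) * pp_eval \<phi> m)" if "r \<in> {p, q, p + q}" for r
    by (rule subst_superset) (use that keys_add[of p q] in auto)
  then show ?thesis by (simp add: lookup_add Const_add sum.distrib distrib_right)
qed

lemma subst_single: "subst \<phi> (single m c) = Const c * pp_eval \<phi> m"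
  by (cases "c = 0") (simp_all add: subst_def)

lemma subst_Const [simp]: "subst \<phi> (Const c) = Const c"
  using subst_single[of \<phi> 0 c] by (simp add: Const_def)

lemma subst_one [simp]: "subst \<phi> 1 = 1"
  using subst_Const[of \<phi> 1] by simp

lemma subst_Var [simp]: "subst \<phi> (Var v) = \<phi> v"
  by (simp add: Var_def subst_single pp_eval_single)

lemma subst_mult: "subst \<phi> (p * q) = subst \<phi> p * subst \<phi> q"
proof -
  have single: "subst \<phi> (single m c * single n d) = subst \<phi> (single m c) * subst \<phi> (single n d)"
    for m n c d
    by (simp only: mult_single subst_single pp_eval_add Const_mult ac_simps)
  have left: "subst \<phi> (single m c * q) = subst \<phi> (single m c) * subst \<phi> q" for m c
    by (induction q rule: mpoly_induct)
      (simp_all only: distrib_left subst_add single subst_zero mult_zero_right)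
  show ?thesis
    by (induction p rule: mpoly_induct)
      (simp_all only: distrib_right subst_add left subst_zero mult_zero_left)
qed

lemma subst_uminus: "subst \<phi> (- p) = - subst \<phi> p"
  using subst_add[of \<phi> p "- p"] minus_unique[of "subst \<phi> p" "subst \<phi> (- p)"] by simp

lemma subst_diff: "subst \<phi> (p - q) = subst \<phi> p - subst \<phi> q"
  using subst_add[of \<phi> p "- q"] by (simp add: subst_uminus)

lemma subst_sum: "subst \<phi> (sum P A) = (\<Sum>a\<in>A. subst \<phi> (P a))"
  by (induction A rule: infinite_finite_induct) (simp_all add: subst_add)

lemma subst_power: "subst \<phi> (p ^ k) = subst \<phi> p ^ k"
  by (induction k) (simp_all add: subst_mult)

lemma subst_pp_eval:
  fixes \<psi> :: "'u \<Rightarrow> ('v, 'a::comm_ring_1) mpoly" and \<phi> :: "'v \<Rightarrow> ('w, 'a) mpoly"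
  shows "subst \<phi> (pp_eval \<psi> m) = pp_eval (\<lambda>v. subst \<phi> (\<psi> v)) m"
proof -
  have "subst \<phi> (prod P A) = (\<Prod>a\<in>A. subst \<phi> (P a))"
    for P :: "'u \<Rightarrow> ('v, 'a) mpoly" and A
    by (induction A rule: infinite_finite_induct) (simp_all add: subst_mult)
  then show ?thesis by (simp add: pp_eval_def subst_power)
qed

lemma subst_subst: "subst \<phi> (subst \<psi> p) = subst (\<lambda>v. subst \<phi> (\<psi> v)) p"
  by (induction p rule: mpoly_induct)
    (simp_all add: subst_add subst_single subst_mult subst_pp_eval)

lemma subst_cong:
  assumes "\<And>v. v \<in> vars p \<Longrightarrow> \<phi> v = \<psi> v"
  shows "subst \<phi> p = subst \<psi> p"
  unfolding subst_def
  by (intro sum.cong refl arg_cong2[where f = "(*)"] pp_eval_cong)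
    (use assms in \<open>auto simp: vars_def\<close>)

lemma pp_eval_Var: "pp_eval Var m = (single m 1 :: ('v, 'a::comm_ring_1) mpoly)"
proof -
  have pow: "(Var v :: ('v, 'a) mpoly) ^ k = single (single v k) 1" for v k
    by (induction k) (simp_all add: Var_def mult_single flip: single_add)
  have "(\<Prod>v\<in>A. Var v ^ lookup m v :: ('v, 'a) mpoly) = single (\<Sum>v\<in>A. single v (lookup m v)) 1"
    if "finite A" for A
    using that by (induction A) (simp_all add: pow mult_single)
  from this[of "keys m"] show ?thesis by (simp add: pp_eval_def sum_singles)
qed

lemma subst_Var_id: "subst Var p = p"
  by (induction p rule: mpoly_induct)
    (simp_all add: subst_add subst_single pp_eval_Var Const_times_single)

text \<open>
  Congruence modulo an ideal is compatible with sums and products, hence with evaluation of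
  polynomials.
\<close>

lemma subst_congruent:
  fixes p :: "('v, 'a::comm_ring_1) mpoly" and \<phi> \<psi> :: "'v \<Rightarrow> ('w, 'a) mpoly"
  assumes "\<And>v. \<phi> v - \<psi> v \<in> ideal.span S"
  shows "subst \<phi> p - subst \<psi> p \<in> ideal.span S"
proof -
  have mult: "a * c - b * d \<in> ideal.span S"
    if "a - b \<in> ideal.span S" "c - d \<in> ideal.span S" for a b c d :: "('w, 'a) mpoly"
  proof -
    have "a * c - b * d = c * (a - b) + b * (c - d)" by (simp add: algebra_simps)
    with that show ?thesis by (simp add: ideal.span_add ideal.span_scale)
  qed
  have pow: "\<phi> v ^ k - \<psi> v ^ k \<in> ideal.span S" for v k
    by (induction k) (simp_all add: ideal.span_zero mult assms)
  have "(\<Prod>v\<in>A. \<phi> v ^ lookup m v) - (\<Prod>v\<in>A. \<psi> v ^ lookup m v) \<in> ideal.span S"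
    for A and m :: "'v pp"
    by (induction A rule: infinite_finite_induct) (simp_all add: ideal.span_zero mult pow)
  then have "pp_eval \<phi> m - pp_eval \<psi> m \<in> ideal.span S" for m
    by (simp add: pp_eval_def)
  then have "Const c * (pp_eval \<phi> m - pp_eval \<psi> m) \<in> ideal.span S" for c m
    by (rule ideal.span_scale)
  then have single: "Const c * pp_eval \<phi> m - Const c * pp_eval \<psi> m \<in> ideal.span S" for c m
    by (simp add: right_diff_distrib)
  show ?thesis
  proof (induction p rule: mpoly_induct)
    case (add p m c)
    from ideal.span_add[OF add single] show ?case
      by (simp add: subst_add subst_single algebra_simps)
  qed (simp add: ideal.span_zero)
qed

lemma keys_minus_subset: "keys (p - q :: 'a \<Rightarrow>\<^sub>0 'b::ab_group_add) \<subseteq> keys p \<union> keys q"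
  by (auto simp: in_keys_iff lookup_minus)

lemma vars_subst:
  fixes p :: "('b, 'c::comm_ring_1) mpoly" and \<phi> :: "'b \<Rightarrow> ('d, 'c) mpoly"
  shows "vars (subst \<phi> p) \<subseteq> (\<Union>v\<in>vars p. vars (\<phi> v))"
proof -
  define Y where "Y = (\<Union>v\<in>vars p. vars (\<phi> v))"
  have mult: "vars (a * b) \<subseteq> Y" if "vars a \<subseteq> Y" "vars b \<subseteq> Y" for a b :: "('d, 'c) mpoly"
  proof
    fix y assume "y \<in> vars (a * b)"
    then obtain m where m: "m \<in> keys (a * b)" "y \<in> keys m" by (auto simp: vars_def)
    obtain k l where kl: "k \<in> keys a" "l \<in> keys b" "m = k + l" using keys_mult m(1) by blast
    then have "y \<in> keys k \<union> keys l" using m(2) keys_add[of k l] by auto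
    with kl that show "y \<in> Y" by (auto simp: vars_def)
  qed
  have const: "vars (Const c :: ('d, 'c) mpoly) = {}" for c by (simp add: vars_def Const_def)
  have const_one: "vars (1 :: ('d, 'c) mpoly) = {}" using const[of 1] by simp
  have pow: "vars (a ^ k) \<subseteq> Y" if "vars a \<subseteq> Y" for a :: "('d, 'c) mpoly" and k
    by (induction k) (use that mult const_one in simp_all)
  have prods: "vars (\<Prod>v\<in>A. \<phi> v ^ lookup m v) \<subseteq> Y" if "A \<subseteq> vars p" for A m
    using that
  proof (induction A rule: infinite_finite_induct)
    case (insert v A)
    then have "vars (\<phi> v) \<subseteq> Y" by (auto simp: Y_def)
    with insert show ?case by (simp add: mult pow)
  qed (simp_all add: const_one)
  have "vars (\<Sum>m\<in>A. Const (lookup p m) * pp_eval \<phi> m) \<subseteq> Y" if "A \<subseteq> keys p" for A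
    using that
  proof (induction A rule: infinite_finite_induct)
    case (insert m A)
    have "vars (Const (lookup p m) * pp_eval \<phi> m) \<subseteq> Y"
      unfolding pp_eval_def using insert.prems
      by (intro mult prods) (simp_all add: const, auto simp: vars_def)
    moreover have "vars (\<Sum>m\<in>A. Const (lookup p m) * pp_eval \<phi> m) \<subseteq> Y"
      using insert by simp
    ultimately show ?case
      using keys_add[of "Const (lookup p m) * pp_eval \<phi> m" "\<Sum>m\<in>A. Const (lookup p m) * pp_eval \<phi> m"]
      unfolding vars_def sum.insert[OF insert.hyps] by blast
  qed (simp_all add: vars_def)
  then show ?thesis by (simp add: subst_def Y_def)
qed

section \<open>Homogeneous polynomials\<close>

lemma wdeg_superset:
  assumes "finite A" "keys m \<subseteq> A"
  shows "wdeg w m = (\<Sum>v\<in>A. w v * lookup m v)"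
  unfolding wdeg_def
  by (rule sum.mono_neutral_left) (use assms in \<open>auto simp: in_keys_iff\<close>)

lemma wdeg_zero [simp]: "wdeg w 0 = 0"
  by (simp add: wdeg_def)

lemma wdeg_single [simp]: "wdeg w (single v k) = w v * k"
  by (simp add: wdeg_def)

lemma wdeg_add: "wdeg w (m + m') = wdeg w m + wdeg w m'"
proof -
  let ?A = "keys m \<union> keys m'"
  have "wdeg w n = (\<Sum>v\<in>?A. w v * lookup n v)" if "n \<in> {m, m', m + m'}" for n
    by (rule wdeg_superset) (use that keys_add[of m m'] in auto)
  then show ?thesis by (simp add: lookup_add distrib_left sum.distrib)
qed

lemma wdeg_eq_0D:
  assumes "wdeg w m = 0" and "\<And>v. 0 < w v"
  shows "m = 0"
proof (rule ccontr)
  assume "m \<noteq> 0"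
  then obtain v where v: "v \<in> keys m" by (metis ex_in_conv keys_eq_empty)
  have "w v * lookup m v \<le> wdeg w m"
    unfolding wdeg_def by (rule member_le_sum) (use v in auto)
  with v assms(1) assms(2)[of v] show False by (auto simp: in_keys_iff)
qed

definition homog :: "('v \<Rightarrow> nat) \<Rightarrow> nat \<Rightarrow> ('v, 'a::zero) mpoly \<Rightarrow> bool" where
  "homog w d p \<longleftrightarrow> (\<forall>m\<in>keys p. wdeg w m = d)"

lemma homog_zero [simp]: "homog w d 0"
  by (simp add: homog_def)

lemma homog_add:
  "homog w d p \<Longrightarrow> homog w d q \<Longrightarrow> homog w d (p + q)"
  using keys_add[of p q] by (auto simp: homog_def)

lemma homog_diff:
  fixes p q :: "('v, 'a::ab_group_add) mpoly"
  shows "homog w d p \<Longrightarrow> homog w d q \<Longrightarrow> homog w d (p - q)"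
  using keys_minus_subset[of p q] by (auto simp: homog_def)

lemma homog_sum:
  "(\<And>a. a \<in> A \<Longrightarrow> homog w d (P a)) \<Longrightarrow> homog w d (sum P A)"
  by (induction A rule: infinite_finite_induct) (simp_all add: homog_add)

lemma homog_single: "wdeg w m = d \<Longrightarrow> homog w d (single m c)"
  by (auto simp: homog_def split: if_splits)

lemma homog_Const: "homog w 0 (Const c)"
  by (simp add: Const_def homog_single)

lemma homog_one: "homog w 0 (1 :: ('v, 'a::comm_ring_1) mpoly)"
  using homog_Const[of w "1 :: 'a"] by simp

lemma homog_mult:
  assumes "homog w d p" "homog w e q"
  shows "homog w (d + e) (p * q)"
  unfolding homog_def
proof
  fix m assume "m \<in> keys (p * q)"
  then obtain k l where "k \<in> keys p" "l \<in> keys q" "m = k + l" using keys_mult by blast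
  with assms show "wdeg w m = d + e" by (simp add: homog_def wdeg_add)
qed

lemma homog_power:
  fixes p :: "('v, 'a::comm_ring_1) mpoly"
  shows "homog w d p \<Longrightarrow> homog w (d * k) (p ^ k)"
  by (induction k) (simp_all add: homog_one homog_mult)

lemma homog_Var: "w v = d \<Longrightarrow> homog w d (Var v)"
  by (simp add: Var_def homog_single)

lemma homog_pp_eval:
  assumes "\<And>v. homog w (w' v) (\<phi> v)"
  shows "homog w (wdeg w' m) (pp_eval \<phi> m)"
proof -
  have "homog w (\<Sum>v\<in>A. w' v * lookup m v) (\<Prod>v\<in>A. \<phi> v ^ lookup m v)" for A
    by (induction A rule: infinite_finite_induct)
      (simp_all add: homog_one homog_mult homog_power assms)
  then show ?thesis by (simp add: wdeg_def pp_eval_def)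
qed

text \<open>
  A substitution that sends every variable to something of its own degree is graded. It is
  needed for \<open>x\<^sub>i \<mapsto> F\<^sub>i\<close>, which is why \<open>x\<^sub>i\<close> is given the degree of \<open>f\<^sub>i\<close>.
\<close>

lemma homog_subst:
  assumes "\<And>v. homog w (w' v) (\<phi> v)" and "homog w' d p"
  shows "homog w d (subst \<phi> p)"
  unfolding subst_def
proof (rule homog_sum)
  fix m assume "m \<in> keys p"
  then have "homog w (0 + d) (Const (lookup p m) * pp_eval \<phi> m)"
    using homog_pp_eval[of w w' \<phi> m] assms by (intro homog_mult homog_Const) (auto simp: homog_def)
  then show "homog w d (Const (lookup p m) * pp_eval \<phi> m)" by simp
qed

lemma pp_eval_dehomogenize:
  "pp_eval (\<lambda>v. if v = h then 1 else Var v) m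
    = (single (m - single h (lookup m h)) 1 :: ('v, 'a::comm_ring_1) mpoly)"
proof -
  let ?\<delta> = "\<lambda>v. if v = h then 1 else Var v :: ('v, 'a) mpoly"
  define n where "n = m - single h (lookup m h)"
  have split: "m = n + single h (lookup m h)"
    by (rule poly_mapping_eqI) (simp add: n_def lookup_add lookup_minus lookup_single when_def)
  have "pp_eval ?\<delta> (n + single h k) = pp_eval ?\<delta> n" for k
    by (simp add: pp_eval_add pp_eval_single)
  then have "pp_eval ?\<delta> m = pp_eval ?\<delta> n"
    by (rule trans[OF arg_cong[OF split]])
  also have "\<dots> = pp_eval Var n"
    by (rule pp_eval_cong) (auto simp: n_def in_keys_iff lookup_minus)
  finally show ?thesis by (simp add: pp_eval_Var n_def)
qed

lemma dehomogenize_eq_sum: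
  fixes p :: "('v, 'a::comm_ring_1) mpoly"
  shows "subst (\<lambda>v. if v = h then 1 else Var v) p
    = (\<Sum>m\<in>keys p. single (m - single h (lookup m h)) (lookup p m))"
  by (simp add: subst_def pp_eval_dehomogenize Const_times_single)

lemma wdeg_dehomogenize:
  fixes p :: "('v, 'a::comm_ring_1) mpoly"
  assumes "homog w d p" "k \<in> keys (subst (\<lambda>v. if v = h then 1 else Var v) p)"
  shows "wdeg w k \<le> d"
proof -
  have "k \<in> (\<Union>m\<in>keys p. keys (single (m - single h (lookup m h)) (lookup p m)))"
    using assms(2) unfolding dehomogenize_eq_sum by (rule subsetD[OF keys_sum])
  then obtain m where m: "m \<in> keys p" "k = m - single h (lookup m h)"
    by (auto split: if_splits)
  have "m = k + single h (lookup m h)"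
    by (rule poly_mapping_eqI) (simp add: m(2) lookup_add lookup_minus lookup_single when_def)
  then have "wdeg w m = wdeg w (k + single h (lookup m h))"
    by (rule arg_cong)
  then have "wdeg w m = wdeg w k + w h * lookup m h"
    by (simp add: wdeg_add)
  with assms(1) m(1) show ?thesis by (simp add: homog_def)
qed

text \<open>
  On monomials of a fixed degree, forgetting the exponent of \<open>h\<close> is injective, because that
  exponent can be recovered from the degree.
\<close>

lemma dehomogenization_eq_0D:
  fixes p :: "('v, 'a::comm_ring_1) mpoly"
  assumes hom: "homog w d p" and wh: "w h = 1"
    and zero: "subst (\<lambda>v. if v = h then 1 else Var v) p = 0"
  shows "p = 0"
proof (rule ccontr)
  assume "p \<noteq> 0"
  then obtain m0 where m0: "m0 \<in> keys p" by (metis ex_in_conv keys_eq_empty)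
  define \<pi> where "\<pi> m = m - single h (lookup m h)" for m :: "'v pp"
  have split: "m = \<pi> m + single h (lookup m h)" for m
    by (rule poly_mapping_eqI) (simp add: \<pi>_def lookup_add lookup_minus lookup_single when_def)
  have sum: "(\<Sum>m\<in>keys p. single (\<pi> m) (lookup p m)) = 0"
    using zero by (simp add: dehomogenize_eq_sum \<pi>_def)
  have inj: "m = m0" if "m \<in> keys p" "\<pi> m = \<pi> m0" for m
  proof -
    have "d = wdeg w (\<pi> k) + lookup k h" if "k \<in> keys p" for k
    proof -
      have "d = wdeg w k" using hom that by (simp add: homog_def)
      also have "\<dots> = wdeg w (\<pi> k + single h (lookup k h))"
        by (rule arg_cong[OF split])
      finally show ?thesis by (simp add: wdeg_add wh)
    qed
    from this[OF m0] this[OF that(1)] have "lookup m h = lookup m0 h"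
      unfolding that(2) by linarith
    have "m = \<pi> m + single h (lookup m h)" by (rule split)
    also have "\<dots> = \<pi> m0 + single h (lookup m0 h)"
      using that(2) \<open>lookup m h = lookup m0 h\<close> by simp
    also have "\<dots> = m0" by (rule split [symmetric])
    finally show ?thesis .
  qed
  have "0 = lookup (\<Sum>m\<in>keys p. single (\<pi> m) (lookup p m)) (\<pi> m0)" by (simp add: sum)
  also have "\<dots> = (\<Sum>m\<in>keys p. if m = m0 then lookup p m0 else 0)"
    unfolding lookup_sum
  proof (rule sum.cong)
    fix m assume "m \<in> keys p"
    then show "lookup (single (\<pi> m) (lookup p m)) (\<pi> m0) = (if m = m0 then lookup p m0 else 0)"
      using inj[of m] by (cases "\<pi> m = \<pi> m0") (simp_all add: lookup_single_not_eq, blast)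
  qed simp
  also have "\<dots> = lookup p m0" using m0 by simp
  finally show False using m0 by (simp add: in_keys_iff)
qed

section \<open>Dickson's lemma\<close>

lemma pp_dvd_iff: "pp_dvd s t \<longleftrightarrow> (\<forall>v. lookup s v \<le> lookup t v)"
proof
  assume "\<forall>v. lookup s v \<le> lookup t v"
  then have "t = s + (t - s)"
    by (intro poly_mapping_eqI) (simp add: lookup_add lookup_minus)
  then show "pp_dvd s t" unfolding pp_dvd_def by blast
qed (auto simp: pp_dvd_def lookup_add)

lemma pp_dvd_add: "u + s = t \<Longrightarrow> pp_dvd s t"
  by (auto simp: pp_dvd_def add.commute)

lemma pp_dvd_trans: "pp_dvd s t \<Longrightarrow> pp_dvd t u \<Longrightarrow> pp_dvd s u"
  by (auto simp: pp_dvd_def add.assoc)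

lemma nat_mono_subseq:
  fixes s :: "nat \<Rightarrow> nat"
  shows "\<exists>r::nat \<Rightarrow> nat. strict_mono r \<and> mono (\<lambda>i. s (r i))"
proof -
  obtain r :: "nat \<Rightarrow> nat" where r: "strict_mono r" and "monoseq (\<lambda>n. s (r n))"
    using seq_monosub by blast
  then consider "mono (\<lambda>n. s (r n))" | "antimono (\<lambda>n. s (r n))"
    by (auto simp: monoseq_iff)
  then show ?thesis
  proof cases
    case 2
    obtain N where N: "\<And>n. s (r N) \<le> s (r n)"
      using ex_has_least_nat[of "\<lambda>_. True" 0 "\<lambda>n. s (r n)"] by blast
    have const: "s (r (N + n)) = s (r N)" for n
      using N[of "N + n"] antimonoD[OF 2, of N "N + n"] by simp
    have "strict_mono (\<lambda>n. r (N + n))"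
      using r by (simp add: strict_mono_def)
    moreover have "mono (\<lambda>n. s (r (N + n)))" by (simp add: mono_def const)
    ultimately show ?thesis by blast
  qed (use r in blast)
qed

text \<open>
  Passing to a subsequence once for each variable makes all exponents nondecreasing.
\<close>

lemma dickson:
  fixes s :: "nat \<Rightarrow> ('v::finite) pp"
  shows "\<exists>i j. i < j \<and> pp_dvd (s i) (s j)"
proof -
  have "\<exists>r::nat \<Rightarrow> nat. strict_mono r \<and> (\<forall>v\<in>A. mono (\<lambda>i. lookup (s (r i)) v))"
    if "finite A" for A
    using that
  proof (induction A)
    case empty
    show ?case by (intro exI[of _ id]) (simp add: strict_mono_def)
  next
    case (insert v A)
    then obtain r :: "nat \<Rightarrow> nat" where r: "strict_mono r"
      "\<And>u. u \<in> A \<Longrightarrow> mono (\<lambda>i. lookup (s (r i)) u)" by blast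
    obtain r' :: "nat \<Rightarrow> nat" where r': "strict_mono r'" "mono (\<lambda>i. lookup (s (r (r' i))) v)"
      using nat_mono_subseq[of "\<lambda>i. lookup (s (r i)) v"] by blast
    have "mono (\<lambda>i. lookup (s (r (r' i))) u)" if "u \<in> A" for u
      using r(2)[OF that] strict_mono_mono[OF r'(1)] by (simp add: mono_def)
    moreover have "strict_mono (\<lambda>i. r (r' i))"
      using r(1) r'(1) by (simp add: strict_mono_def)
    ultimately show ?case using r'(2) by (intro exI[of _ "\<lambda>i. r (r' i)"]) auto
  qed
  from this[of UNIV] obtain r :: "nat \<Rightarrow> nat" where r: "strict_mono r"
    and mono: "\<And>v. mono (\<lambda>i. lookup (s (r i)) v)" by auto
  have "r 0 < r 1" using r by (simp add: strict_mono_def)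
  moreover have "pp_dvd (s (r 0)) (s (r 1))"
    unfolding pp_dvd_iff using mono by (simp add: mono_def)
  ultimately show ?thesis by blast
qed

text \<open>
  The ascending chain condition for monomial ideals, which appear here as sets of monomials closed
  under multiples. In an infinite strict chain, choose a new monomial at each step; one of them would
  divide a later one, which was then not new.
\<close>

lemma wf_up_closed_supset:
  "wf {(A, B :: ('v::finite) pp set). B \<subset> A \<and> (\<forall>s\<in>A. \<forall>t. pp_dvd s t \<longrightarrow> t \<in> A)}"
  unfolding wf_iff_no_infinite_down_chain
proof
  assume "\<exists>f :: nat \<Rightarrow> 'v pp set. \<forall>i. (f (Suc i), f i)
    \<in> {(A, B). B \<subset> A \<and> (\<forall>s\<in>A. \<forall>t. pp_dvd s t \<longrightarrow> t \<in> A)}"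
  then obtain f :: "nat \<Rightarrow> 'v pp set" where
    "\<forall>i. f i \<subset> f (Suc i) \<and> (\<forall>s\<in>f (Suc i). \<forall>t. pp_dvd s t \<longrightarrow> t \<in> f (Suc i))"
    by auto
  then have f: "f i \<subset> f (Suc i)" "s \<in> f (Suc i) \<Longrightarrow> pp_dvd s t \<Longrightarrow> t \<in> f (Suc i)" for i s t
    by simp_all
  have "\<forall>i. \<exists>s. s \<in> f (Suc i) \<and> s \<notin> f i"
    using psubset_imp_ex_mem[OF f(1)] by simp
  then obtain s where s: "\<And>i. s i \<in> f (Suc i)" "\<And>i. s i \<notin> f i"
    by metis
  obtain i j where ij: "i < j" "pp_dvd (s i) (s j)" using dickson[of s] by blast
  from ij(1) obtain k where k: "j = Suc k" "i \<le> k" by (cases j) auto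
  have "f (Suc i) \<subseteq> f j" using f(1) ij(1) lift_Suc_mono_le[of f "Suc i" j] by (auto simp: psubset_eq)
  then have "s j \<in> f j" using f(2)[of _ k] s(1)[of i] ij(2) k(1) by blast
  then show False using s(2) by blast
qed

section \<open>Leading terms\<close>

lemma keys_monom_mult: "keys (single t c * p) \<subseteq> (+) t ` keys p"
  using keys_mult[of "single t c" p] by (auto split: if_splits)

lemma lookup_monom_mult:
  fixes p :: "('v, 'a::comm_ring_1) mpoly"
  shows "lookup (single t c * p) (t + m) = c * lookup p m"
proof (induction p rule: mpoly_induct)
  case (add p k d)
  then show ?case
    by (simp add: distrib_left lookup_add mult_single lookup_single when_def)
qed simp

locale term_order =
  fixes \<sigma> :: "('v::finite) pp rel"
  assumes term_ordering: "term_ordering \<sigma>"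
begin

abbreviation le (infix "\<sqsubseteq>" 50) where "s \<sqsubseteq> t \<equiv> (s, t) \<in> \<sigma>"
abbreviation lt (infix "\<sqsubset>" 50) where "s \<sqsubset> t \<equiv> s \<sqsubseteq> t \<and> s \<noteq> t"

lemma le_refl: "s \<sqsubseteq> s"
  and le_antisym: "s \<sqsubseteq> t \<Longrightarrow> t \<sqsubseteq> s \<Longrightarrow> s = t"
  and le_trans: "s \<sqsubseteq> t \<Longrightarrow> t \<sqsubseteq> u \<Longrightarrow> s \<sqsubseteq> u"
  and le_total: "s \<sqsubseteq> t \<or> t \<sqsubseteq> s"
  and le_add: "s \<sqsubseteq> t \<Longrightarrow> u + s \<sqsubseteq> u + t"
  and zero_le: "0 \<sqsubseteq> t"
proof -
  from term_ordering have "linear_order \<sigma>" by (simp add: term_ordering_def)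
  then have "refl \<sigma>" "antisym \<sigma>" "trans \<sigma>" "total \<sigma>"
    by (simp_all add: linear_order_on_def partial_order_on_def preorder_on_def)
  then show "s \<sqsubseteq> s" "s \<sqsubseteq> t \<Longrightarrow> t \<sqsubseteq> s \<Longrightarrow> s = t" "s \<sqsubseteq> t \<Longrightarrow> t \<sqsubseteq> u \<Longrightarrow> s \<sqsubseteq> u"
    "s \<sqsubseteq> t \<or> t \<sqsubseteq> s"
    by (auto simp: refl_on_def total_on_def dest: antisymD transD) metis
  show "s \<sqsubseteq> t \<Longrightarrow> u + s \<sqsubseteq> u + t" "0 \<sqsubseteq> t"
    using term_ordering by (auto simp: term_ordering_def add.commute)
qed

lemma le_lt_trans: "s \<sqsubseteq> t \<Longrightarrow> t \<sqsubset> u \<Longrightarrow> s \<sqsubset> u"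
  using le_antisym le_trans by blast

text \<open>
  A term ordering refines divisibility, so a strictly decreasing sequence would contradict
  Dickson's lemma.
\<close>

lemma wf_lt: "wf {(s, t). s \<sqsubset> t}"
  unfolding wf_iff_no_infinite_down_chain
proof
  assume "\<exists>f :: nat \<Rightarrow> 'v pp. \<forall>i. (f (Suc i), f i) \<in> {(s, t). s \<sqsubset> t}"
  then obtain f :: "nat \<Rightarrow> 'v pp" where f: "\<And>i. f (Suc i) \<sqsubset> f i" by blast
  obtain i j where ij: "i < j" "pp_dvd (f i) (f j)" using dickson[of f] by blast
  then obtain u where u: "f j = f i + u" by (auto simp: pp_dvd_def)
  have "f j \<sqsubset> f i"
    using ij(1)
  proof (induction rule: less_Suc_induct)
    case (2 i j k)
    then show ?case using le_lt_trans by blast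
  qed (rule f)
  moreover have "f i \<sqsubseteq> f j" using le_add[OF zero_le[of u], of "f i"] by (simp add: u)
  ultimately show False using le_antisym by blast
qed

lemma LT_eqI: "m \<in> keys p \<Longrightarrow> (\<And>k. k \<in> keys p \<Longrightarrow> k \<sqsubseteq> m) \<Longrightarrow> LT \<sigma> p = m"
  unfolding LT_def by (rule the_equality) (auto intro: le_antisym)

lemma finite_has_maximum: "finite A \<Longrightarrow> A \<noteq> {} \<Longrightarrow> \<exists>m\<in>A. \<forall>k\<in>A. k \<sqsubseteq> m"
proof (induction A rule: finite_ne_induct)
  case (insert a A)
  then obtain m where m: "m \<in> A" "\<And>k. k \<in> A \<Longrightarrow> k \<sqsubseteq> m" by blast
  then show ?case using le_total[of a m] le_trans le_refl by (metis insert_iff)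
qed (simp add: le_refl)

lemma LT_in_keys: "p \<noteq> 0 \<Longrightarrow> LT \<sigma> p \<in> keys p"
  and keys_le_LT: "k \<in> keys p \<Longrightarrow> k \<sqsubseteq> LT \<sigma> p"
proof -
  have *: "\<exists>m\<in>keys p. LT \<sigma> p = m \<and> (\<forall>k\<in>keys p. k \<sqsubseteq> m)" if "p \<noteq> 0"
    using finite_has_maximum[of "keys p"] that LT_eqI by (metis finite_keys keys_eq_empty)
  then show "p \<noteq> 0 \<Longrightarrow> LT \<sigma> p \<in> keys p" by blast
  show "k \<in> keys p \<Longrightarrow> k \<sqsubseteq> LT \<sigma> p" using * by (cases "p = 0") auto
qed

lemma LC_nonzero: "p \<noteq> 0 \<Longrightarrow> LC \<sigma> p \<noteq> 0"
  using LT_in_keys[of p] by (simp add: LC_def in_keys_iff)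

lemma keys_monom_mult_le: "k \<in> keys (single t c * p) \<Longrightarrow> k \<sqsubseteq> t + LT \<sigma> p"
  using keys_monom_mult[of t c p] keys_le_LT le_add by blast

text \<open>
  Multiplicativity of leading coefficients. It is stated for upper bounds \<open>s\<close> and \<open>t\<close> of the
  supports, and it yields both the absence of zero divisors and the additivity of degrees.
\<close>

lemma lookup_mult_max:
  fixes p q :: "('v, 'a::comm_ring_1) mpoly"
  assumes p: "\<And>k. k \<in> keys p \<Longrightarrow> k \<sqsubseteq> s" and q: "\<And>k. k \<in> keys q \<Longrightarrow> k \<sqsubseteq> t"
  shows "lookup (p * q) (s + t) = lookup p s * lookup q t"
proof -
  have uniq: "a = s \<and> b = t" if "a + b = s + t" "a \<in> keys p" "b \<in> keys q" for a b
  proof -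
    have "a + b \<sqsubseteq> a + t" "a + t \<sqsubseteq> s + t"
      using le_add[OF q[OF that(3)], of a] le_add[OF p[OF that(2)], of t] by (simp_all add: add.commute)
    then have "a + t = s + t" using that(1) le_antisym by metis
    then show ?thesis using that(1) by simp
  qed
  have "p * q = (\<Sum>a\<in>keys p. \<Sum>b\<in>keys q. single (a + b) (lookup p a * lookup q b))"
    by (subst (1 2) sum_singles [symmetric]) (simp only: sum_product mult_single)
  then have sum: "lookup (p * q) (s + t)
    = (\<Sum>a\<in>keys p. \<Sum>b\<in>keys q. if a + b = s + t then lookup p a * lookup q b else 0)"
    by (simp add: lookup_sum lookup_single when_def)
  have lookup_0: "lookup r k = 0" if "k \<notin> keys r" for r :: "('v, 'a) mpoly" and k
    using that by (simp add: in_keys_iff)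
  note sum
  also have "(\<Sum>a\<in>keys p. \<Sum>b\<in>keys q. if a + b = s + t then lookup p a * lookup q b else 0)
    = (\<Sum>a\<in>keys p. \<Sum>b\<in>keys q. if b = t then if a = s then lookup p s * lookup q t else 0 else 0)"
    by (intro sum.cong refl) (use uniq in auto)
  also have "\<dots> = lookup p s * lookup q t"
    using lookup_0[of s p] lookup_0[of t q]
    by (cases "s \<in> keys p"; cases "t \<in> keys q") simp_all
  finally show ?thesis .
qed

section \<open>S-polynomials and reduction\<close>

lemma pp_dvd_minus_add: "pp_dvd s m \<Longrightarrow> m - s + s = m"
  by (auto simp: pp_dvd_def add.commute)

text \<open>
  The multiple of \<open>b\<close> that a reduction step or an S-polynomial subtracts is scaled to have the
  prescribed coefficient \<open>c\<close> at its leading monomial \<open>m\<close>.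
\<close>

lemma monom_mult_cancel_LT:
  fixes b :: "('v, 'a::field) mpoly"
  assumes "b \<noteq> 0" "pp_dvd (LT \<sigma> b) m"
  shows "lookup (single (m - LT \<sigma> b) (c / LC \<sigma> b) * b) m = c"
    and "k \<in> keys (single (m - LT \<sigma> b) (c / LC \<sigma> b) * b) \<Longrightarrow> k \<sqsubseteq> m"
proof -
  note m = pp_dvd_minus_add[OF assms(2)]
  show "lookup (single (m - LT \<sigma> b) (c / LC \<sigma> b) * b) m = c"
    using lookup_monom_mult[of "m - LT \<sigma> b" "c / LC \<sigma> b" b "LT \<sigma> b"] LC_nonzero[OF assms(1)]
    by (simp add: m LC_def)
  show "k \<in> keys (single (m - LT \<sigma> b) (c / LC \<sigma> b) * b) \<Longrightarrow> k \<sqsubseteq> m"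
    using keys_monom_mult_le[of k "m - LT \<sigma> b" "c / LC \<sigma> b" b] by (simp add: m)
qed

lemma pp_dvd_lcm: "pp_dvd s (pp_lcm s t)" "pp_dvd t (pp_lcm s t)"
  by (auto simp: pp_dvd_iff pp_lcm_def lookup_add lookup_minus)

lemma pp_lcm_commute: "pp_lcm s t = pp_lcm t s"
  by (rule poly_mapping_eqI) (simp add: pp_lcm_def lookup_add lookup_minus)

lemma pp_lcm_least:
  assumes "pp_dvd s m" "pp_dvd t m"
  shows "pp_dvd (pp_lcm s t) m"
  unfolding pp_dvd_iff
proof
  fix v
  have "lookup s v \<le> lookup m v" "lookup t v \<le> lookup m v"
    using assms by (simp_all add: pp_dvd_iff)
  then show "lookup (pp_lcm s t) v \<le> lookup m v"
    by (simp add: pp_lcm_def lookup_add lookup_minus)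
qed

lemma spoly_keys_lt:
  fixes p q :: "('v, 'a::field) mpoly"
  assumes "p \<noteq> 0" "q \<noteq> 0" "k \<in> keys (spoly \<sigma> p q)"
  shows "k \<sqsubset> pp_lcm (LT \<sigma> p) (LT \<sigma> q)"
proof -
  let ?l = "pp_lcm (LT \<sigma> p) (LT \<sigma> q)"
  note P = monom_mult_cancel_LT[OF assms(1) pp_dvd_lcm(1)[of _ "LT \<sigma> q"], where c = 1]
  note Q = monom_mult_cancel_LT[OF assms(2) pp_dvd_lcm(2)[of _ "LT \<sigma> p"], where c = 1]
  have "lookup (spoly \<sigma> p q) ?l = 0"
    using P(1) Q(1) by (simp add: spoly_def Let_def lookup_minus)
  then have "k \<noteq> ?l" using assms(3) by (auto simp: in_keys_iff)
  moreover have "k \<sqsubseteq> ?l"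
    using assms(3) P(2)[of k] Q(2)[of k] keys_minus_subset
    unfolding spoly_def Let_def by (meson UnE subsetD)
  ultimately show ?thesis by simp
qed

lemma homog_spoly:
  fixes p q :: "('v, 'a::field) mpoly"
  assumes "p \<noteq> 0" "q \<noteq> 0" "homog w d p" "homog w e q"
  shows "homog w (pair_degree w \<sigma> p q) (spoly \<sigma> p q)"
proof -
  let ?l = "pp_lcm (LT \<sigma> p) (LT \<sigma> q)"
  have "homog w (wdeg w ?l) (single (?l - LT \<sigma> b) (1 / LC \<sigma> b) * b)"
    if "b \<noteq> 0" "homog w c b" "pp_dvd (LT \<sigma> b) ?l" for b :: "('v, 'a) mpoly" and c
  proof -
    have "wdeg w (LT \<sigma> b) = c" using LT_in_keys that by (auto simp: homog_def)
    then have "wdeg w ?l = wdeg w (?l - LT \<sigma> b) + c"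
      using pp_dvd_minus_add[OF that(3)] wdeg_add by metis
    then show ?thesis using homog_mult[OF homog_single that(2)] by metis
  qed
  then show ?thesis
    unfolding spoly_def Let_def pair_degree_def using assms pp_dvd_lcm by (intro homog_diff) blast+
qed

lemma spoly_commute: "spoly \<sigma> q p = - spoly \<sigma> p q"
  by (simp add: spoly_def Let_def pp_lcm_commute)

lemma pair_degree_commute: "pair_degree w \<sigma> q p = pair_degree w \<sigma> p q"
  by (simp add: pair_degree_def pp_lcm_commute)

text \<open>
  A step may reduce any term, not only the leading one, so leading terms do not measure progress. The
  multiset of all monomials does: one of them is replaced by finitely many smaller ones.
\<close>

lemma red_decreases:
  fixes p q :: "('v, 'a::field) mpoly"
  assumes "red \<sigma> B p q"
  shows "(mset_set (keys q), mset_set (keys p)) \<in> mult {(s, t). s \<sqsubset> t}"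
proof -
  from assms obtain b m where b: "b \<noteq> 0" "pp_dvd (LT \<sigma> b) m" and m: "m \<in> keys p"
    and q: "q = p - single (m - LT \<sigma> b) (lookup p m / LC \<sigma> b) * b"
    unfolding red_def by blast
  note M = monom_mult_cancel_LT[OF b, where c = "lookup p m"]
  let ?I = "keys p \<inter> keys q" and ?K = "keys q - keys p" and ?J = "keys p - keys q"
  have "m \<notin> keys q" using M(1) by (simp add: q in_keys_iff lookup_minus)
  then have mJ: "m \<in> ?J" using m by blast
  have "k \<sqsubset> m" if "k \<in> ?K" for k
  proof -
    have "k \<in> keys (single (m - LT \<sigma> b) (lookup p m / LC \<sigma> b) * b)"
      using that keys_minus_subset[of p "single (m - LT \<sigma> b) (lookup p m / LC \<sigma> b) * b"]
      unfolding q by blast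
    then show ?thesis using M(2) that m by blast
  qed
  then have "(mset_set ?I + mset_set ?K, mset_set ?I + mset_set ?J) \<in> mult {(s, t). s \<sqsubset> t}"
    using mJ by (intro one_step_implies_mult) (auto simp: mset_set_empty_iff)
  moreover have "mset_set ?I + mset_set ?K = mset_set (keys q)"
    by (subst mset_set_Union [symmetric]) (auto intro: arg_cong[where f = mset_set])
  moreover have "mset_set ?I + mset_set ?J = mset_set (keys p)"
    by (subst mset_set_Union [symmetric]) (auto intro: arg_cong[where f = mset_set])
  ultimately show "(mset_set (keys q), mset_set (keys p)) \<in> mult {(s, t). s \<sqsubset> t}" by simp
qed

lemma irreducible_LT:
  fixes b r :: "('v, 'a::field) mpoly"
  assumes "\<nexists>r'. red \<sigma> B r r'" "r \<noteq> 0" "b \<in> B" "b \<noteq> 0"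
  shows "\<not> pp_dvd (LT \<sigma> b) (LT \<sigma> r)"
  using assms LT_in_keys unfolding red_def by blast

section \<open>Buchberger's criterion in a fixed degree\<close>

text \<open>
  The linear span of the monomial multiples \<open>t * b\<close> with \<open>b\<close> in \<open>B\<close> whose leading monomials lie
  in \<open>S\<close>. With \<open>S\<close> the monomials below a bound, these are the polynomials with a standard
  representation below that bound. Restricting \<open>S\<close> to one degree makes the criterion
  work for that degree alone.
\<close>

inductive_set rep :: "('v, 'a::field) mpoly set \<Rightarrow> 'v pp set \<Rightarrow> ('v, 'a) mpoly set"
  for B :: "('v, 'a) mpoly set" and S :: "'v pp set" where
  rep_zero: "0 \<in> rep B S"
| rep_add: "p \<in> rep B S \<Longrightarrow> b \<in> B \<Longrightarrow> t + LT \<sigma> b \<in> S \<Longrightarrow> p + single t c * b \<in> rep B S"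

lemma rep_monom: "b \<in> B \<Longrightarrow> t + LT \<sigma> b \<in> S \<Longrightarrow> single t c * b \<in> rep B S"
  using rep_add[OF rep_zero] by simp

lemma rep_plus: "p \<in> rep B S \<Longrightarrow> q \<in> rep B S \<Longrightarrow> p + q \<in> rep B S"
  by (rotate_tac, induction q rule: rep.induct) (simp_all add: rep_add flip: add.assoc)

lemma rep_monom_mult:
  "p \<in> rep B S \<Longrightarrow> (\<And>m. m \<in> S \<Longrightarrow> u + m \<in> S') \<Longrightarrow> single u c * p \<in> rep B S'"
proof (induction p rule: rep.induct)
  case (rep_add p b t d)
  have "single u c * (single t d * b) = single (u + t) (c * d) * b"
    by (simp add: mult_single flip: mult.assoc)
  with rep_add show ?case
    by (simp add: distrib_left rep.rep_add add.assoc)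
qed (simp add: rep_zero)

lemma rep_uminus: "p \<in> rep B S \<Longrightarrow> - p \<in> rep B S"
  using rep_monom_mult[of p B S 0 S "- 1"] by (simp add: single_uminus)

lemma rep_mono: "p \<in> rep B S \<Longrightarrow> B \<subseteq> B' \<Longrightarrow> S \<subseteq> S' \<Longrightarrow> p \<in> rep B' S'"
  by (induction p rule: rep.induct) (auto intro: rep_zero rep_add)

lemma rep_keys: "p \<in> rep B S \<Longrightarrow> k \<in> keys p \<Longrightarrow> \<exists>m\<in>S. k \<sqsubseteq> m"
proof (induction p rule: rep.induct)
  case (rep_add p b t c)
  then show ?case using keys_add[of p "single t c * b"] keys_monom_mult_le by blast
qed simp

lemma rep_bounded: "p \<in> rep B S \<Longrightarrow> p = 0 \<or> (\<exists>m\<in>S. p \<in> rep B {k\<in>S. k \<sqsubseteq> m})"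
proof (induction p rule: rep.induct)
  case (rep_add p b t c)
  let ?n = "t + LT \<sigma> b"
  have n: "?n \<in> S" using rep_add.hyps by simp
  have "\<exists>m\<in>S. p \<in> rep B {k\<in>S. k \<sqsubseteq> m} \<and> ?n \<sqsubseteq> m"
  proof (cases "p = 0")
    case True
    then show ?thesis using n rep_zero le_refl by blast
  next
    case False
    then obtain m where m: "m \<in> S" "p \<in> rep B {k\<in>S. k \<sqsubseteq> m}" using rep_add.IH by blast
    show ?thesis
    proof (cases "?n \<sqsubseteq> m")
      case False
      then have "m \<sqsubseteq> ?n" using le_total by blast
      then have "p \<in> rep B {k\<in>S. k \<sqsubseteq> ?n}"
        by (intro rep_mono[OF m(2)]) (auto intro: le_trans)
      then show ?thesis using n le_refl by blast
    qed (use m in blast)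
  qed
  then obtain m where m: "m \<in> S" "p \<in> rep B {k\<in>S. k \<sqsubseteq> m}" "?n \<sqsubseteq> m" by blast
  then have "p + single t c * b \<in> rep B {k\<in>S. k \<sqsubseteq> m}"
    using rep_add.hyps by (intro rep.rep_add) auto
  then show ?case using m(1) by blast
qed simp

text \<open>
  For homogeneous \<open>p\<close> and \<open>q\<close> this follows when the S-polynomial reduces to zero modulo \<open>B\<close>,
  and it survives enlarging \<open>B\<close>.
\<close>

definition resolved :: "('v \<Rightarrow> nat) \<Rightarrow> ('v, 'a::field) mpoly set
    \<Rightarrow> ('v, 'a) mpoly \<Rightarrow> ('v, 'a) mpoly \<Rightarrow> bool" where
  "resolved w B p q \<longleftrightarrow> spoly \<sigma> p q
     \<in> rep B {m. wdeg w m = pair_degree w \<sigma> p q \<and> m \<sqsubset> pp_lcm (LT \<sigma> p) (LT \<sigma> q)}"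

lemma resolved_commute: "resolved w B q p \<longleftrightarrow> resolved w B p q"
proof -
  have "resolved w B q p" if "resolved w B p q" for p q
    using rep_uminus[OF that[unfolded resolved_def]] unfolding resolved_def
    by (simp add: spoly_commute[of q] pair_degree_commute[of w q] pp_lcm_commute)
  then show ?thesis by blast
qed

lemma resolved_mono: "resolved w B p q \<Longrightarrow> B \<subseteq> B' \<Longrightarrow> resolved w B' p q"
  unfolding resolved_def by (erule rep_mono) auto

text \<open>
  Two monic monomial multiples with the same leading monomial \<open>m\<close> differ by a monomial multiple
  of the S-polynomial, because \<open>m\<close> is a multiple of the least common multiple.
\<close>

lemma resolved_multiples:
  fixes B :: "('v, 'a::field) mpoly set"
  assumes nz: "p \<noteq> 0" "q \<noteq> 0" and res: "p \<noteq> q \<Longrightarrow> resolved w B p q"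
    and s: "s + LT \<sigma> p = m" and t: "t + LT \<sigma> q = m"
  shows "single s (1 / LC \<sigma> p) * p - single t (1 / LC \<sigma> q) * q
    \<in> rep B {k. wdeg w k = wdeg w m \<and> k \<sqsubset> m}"
proof (cases "p = q")
  case True
  then have "s + LT \<sigma> p = t + LT \<sigma> p" using s t by simp
  then show ?thesis using True rep_zero by simp
next
  case False
  let ?l = "pp_lcm (LT \<sigma> p) (LT \<sigma> q)"
  have "pp_dvd (LT \<sigma> p) m" "pp_dvd (LT \<sigma> q) m"
    using s t by (simp_all add: pp_dvd_add)
  then have "pp_dvd ?l m" by (rule pp_lcm_least)
  then obtain u where u: "m = u + ?l" by (auto simp: pp_dvd_def add.commute)
  have "s + LT \<sigma> p = u + (?l - LT \<sigma> p) + LT \<sigma> p"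
    unfolding s u add.assoc pp_dvd_minus_add[OF pp_dvd_lcm(1)] ..
  moreover have "t + LT \<sigma> q = u + (?l - LT \<sigma> q) + LT \<sigma> q"
    unfolding t u add.assoc pp_dvd_minus_add[OF pp_dvd_lcm(2)] ..
  ultimately have st: "s = u + (?l - LT \<sigma> p)" "t = u + (?l - LT \<sigma> q)" by simp_all
  have "single u 1 * spoly \<sigma> p q
    = single s (1 / LC \<sigma> p) * p - single t (1 / LC \<sigma> q) * q"
    by (simp add: spoly_def Let_def right_diff_distrib mult_single st flip: mult.assoc)
  moreover have "single u 1 * spoly \<sigma> p q \<in> rep B {k. wdeg w k = wdeg w m \<and> k \<sqsubset> m}"
    by (rule rep_monom_mult[OF res[OF False, unfolded resolved_def]])
      (auto simp: u wdeg_add pair_degree_def le_add)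
  ultimately show ?thesis by simp
qed

text \<open>
  By the preceding lemma, the multiples \<open>t * b\<close> with leading monomial \<open>m\<close> span at most one
  dimension modulo those with smaller leading monomial. So all terms of a representation that reach \<open>m\<close>
  can be merged into a single one.
\<close>

lemma rep_top_term:
  fixes B :: "('v, 'a::field) mpoly set"
  assumes nz: "0 \<notin> B"
    and res: "\<And>p q. p \<in> B \<Longrightarrow> q \<in> B \<Longrightarrow> p \<noteq> q \<Longrightarrow> pair_degree w \<sigma> p q \<le> d \<Longrightarrow> resolved w B p q"
    and f: "f \<in> rep B {k. wdeg w k = d \<and> k \<sqsubseteq> m}"
  shows "f \<in> rep B {k. wdeg w k = d \<and> k \<sqsubset> m} \<or>
    (\<exists>b\<in>B. \<exists>t c. t + LT \<sigma> b = m \<and> f - single t (c / LC \<sigma> b) * b \<in> rep B {k. wdeg w k = d \<and> k \<sqsubset> m})"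
    (is "_ \<in> ?R \<or> _")
  using f
proof (induction f rule: rep.induct)
  case (rep_add f b t c)
  then have b: "b \<noteq> 0" using nz by blast
  show ?case
  proof (cases "t + LT \<sigma> b = m")
    case False
    then have tb: "single t c * b \<in> ?R" using rep_add.hyps by (intro rep_monom) auto
    from rep_add.IH show ?thesis
    proof (elim disjE bexE exE conjE)
      assume "f \<in> ?R"
      then show ?thesis using rep_plus tb by blast
    next
      fix b' t' c' assume *: "b' \<in> B" "t' + LT \<sigma> b' = m" "f - single t' (c' / LC \<sigma> b') * b' \<in> ?R"
      have "f + single t c * b - single t' (c' / LC \<sigma> b') * b' \<in> ?R"
        using rep_plus[OF *(3) tb] by (simp add: diff_add_eq)
      then show ?thesis using *(1,2) by blast
    qed
  next
    case m: True
    then have d: "wdeg w m = d" using rep_add.hyps by auto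
    from rep_add.IH show ?thesis
    proof (elim disjE bexE exE conjE)
      assume "f \<in> ?R"
      then have "f + single t c * b - single t (c * LC \<sigma> b / LC \<sigma> b) * b \<in> ?R"
        using LC_nonzero[OF b] by simp
      then show ?thesis using m rep_add.hyps by blast
    next
      fix b' t' c' assume *: "b' \<in> B" "t' + LT \<sigma> b' = m" "f - single t' (c' / LC \<sigma> b') * b' \<in> ?R"
      then have b': "b' \<noteq> 0" using nz by blast
      let ?g = "single t (1 / LC \<sigma> b) * b - single t' (1 / LC \<sigma> b') * b'"
      have deg: "pair_degree w \<sigma> b b' \<le> d"
      proof -
        have "pp_dvd (pp_lcm (LT \<sigma> b) (LT \<sigma> b')) m"
          using m *(2) by (intro pp_lcm_least) (simp_all add: pp_dvd_add)
        then show ?thesis using d by (auto simp: pp_dvd_def pair_degree_def wdeg_add)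
      qed
      have "b \<noteq> b' \<Longrightarrow> resolved w B b b'"
        using res rep_add.hyps(2) *(1) deg by blast
      from resolved_multiples[OF b b' this m *(2)] have "?g \<in> ?R"
        by (simp add: d)
      then have "single 0 (c * LC \<sigma> b) * ?g \<in> ?R" by (rule rep_monom_mult) simp
      also have "single 0 (c * LC \<sigma> b) * ?g
        = single t c * b - single t' (c * LC \<sigma> b / LC \<sigma> b') * b'"
        using LC_nonzero[OF b] by (simp add: right_diff_distrib mult_single flip: mult.assoc)
      finally have "(f - single t' (c' / LC \<sigma> b') * b')
        + (single t c * b - single t' (c * LC \<sigma> b / LC \<sigma> b') * b') \<in> ?R"
        by (rule rep_plus[OF *(3)])
      also have "(f - single t' (c' / LC \<sigma> b') * b')
        + (single t c * b - single t' (c * LC \<sigma> b / LC \<sigma> b') * b')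
        = f + single t c * b - single t' ((c' + c * LC \<sigma> b) / LC \<sigma> b') * b'"
        by (simp add: add_divide_distrib single_add algebra_simps)
      finally show ?thesis using * by blast
    qed
  qed
qed (simp add: rep_zero)

text \<open>
  Descent on the largest leading monomial \<open>m\<close> in a representation of \<open>f\<close>. After merging the
  terms that reach \<open>m\<close>, either the coefficient of \<open>f\<close> at \<open>m\<close> is nonzero and \<open>m\<close> is the leading
  monomial of \<open>f\<close>, or the merged term vanishes and \<open>m\<close> can be lowered. All monomials involved
  have degree \<open>d\<close>, and the least common multiples divide them, so only pairs of degree at most
  \<open>d\<close> matter.
\<close>

lemma truncated_buchberger_criterion:
  fixes B :: "('v, 'a::field) mpoly set"
  assumes nz: "0 \<notin> B"
    and res: "\<And>p q. p \<in> B \<Longrightarrow> q \<in> B \<Longrightarrow> p \<noteq> q \<Longrightarrow> pair_degree w \<sigma> p q \<le> d \<Longrightarrow> resolved w B p q"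
    and f: "f \<in> rep B {k. wdeg w k = d}" "f \<noteq> 0"
  shows "\<exists>b\<in>B. pp_dvd (LT \<sigma> b) (LT \<sigma> f)"
proof -
  have *: "\<exists>b\<in>B. pp_dvd (LT \<sigma> b) (LT \<sigma> f)" if "f \<in> rep B {k. wdeg w k = d \<and> k \<sqsubseteq> m}" for m
    using that
  proof (induction m rule: wf_induct_rule[OF wf_lt])
    case (1 m)
    let ?R = "rep B {k. wdeg w k = d \<and> k \<sqsubset> m}"
    have below: ?case if R: "f \<in> ?R"
    proof -
      obtain m' where m': "m' \<sqsubset> m" "f \<in> rep B {k \<in> {k. wdeg w k = d \<and> k \<sqsubset> m}. k \<sqsubseteq> m'}"
        using rep_bounded[OF R] f(2) by blast
      then have "f \<in> rep B {k. wdeg w k = d \<and> k \<sqsubseteq> m'}" by (elim rep_mono) auto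
      then show ?thesis using "1.IH" m'(1) by blast
    qed
    have "f \<in> ?R \<or> (\<exists>b\<in>B. \<exists>t c. t + LT \<sigma> b = m \<and> f - single t (c / LC \<sigma> b) * b \<in> ?R)"
      by (rule rep_top_term[OF nz _ "1.prems"]) (rule res; assumption)
    then show ?case
    proof (elim disjE bexE exE conjE)
      fix b t c assume b: "b \<in> B" "t + LT \<sigma> b = m" and R: "f - single t (c / LC \<sigma> b) * b \<in> ?R"
      have "b \<noteq> 0" using b nz by blast
      have "lookup (f - single t (c / LC \<sigma> b) * b) m = 0"
        using rep_keys[OF R, of m] le_antisym by (auto simp: in_keys_iff)
      then have c: "lookup f m = c"
        using lookup_monom_mult[of t "c / LC \<sigma> b" b "LT \<sigma> b"] LC_nonzero[OF \<open>b \<noteq> 0\<close>] b(2)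
        by (simp add: lookup_minus LC_def)
      show ?thesis
      proof (cases "c = 0")
        case True
        then show ?thesis using R below by simp
      next
        case False
        have "k \<sqsubseteq> m" if "k \<in> keys f" for k
          using rep_keys[OF "1.prems" that] le_trans by blast
        with False c have "LT \<sigma> f = m" by (intro LT_eqI) (simp_all add: in_keys_iff)
        then show ?thesis using b pp_dvd_add by blast
      qed
    qed (rule below)
  qed
  from rep_bounded[OF f(1)] f(2) obtain m where "f \<in> rep B {k \<in> {k. wdeg w k = d}. k \<sqsubseteq> m}" by blast
  then show ?thesis using *[of m] by simp
qed

text \<open>
  In any expression of \<open>p\<close> by the generators, the terms of degree other than \<open>d\<close> cancel; taking
  the part of degree \<open>d\<close> discards them.
\<close>

lemma homog_span_rep:
  fixes B :: "('v, 'a::field) mpoly set"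
  assumes hom: "\<And>b. b \<in> B \<Longrightarrow> \<exists>e. homog w e b"
    and p: "p \<in> ideal.span B" "homog w d p"
  shows "p \<in> rep B {m. wdeg w m = d}"
proof -
  define part where "part q = (\<Sum>m | m \<in> keys q \<and> wdeg w m = d. single m (lookup q m))"
    for q :: "('v, 'a) mpoly"
  have lookup_part: "lookup (part q) m = (if wdeg w m = d then lookup q m else 0)" for q m
    by (auto simp: part_def lookup_sum lookup_single when_def in_keys_iff)
  have part_add: "part (q + r) = part q + part r" for q r
    by (rule poly_mapping_eqI) (simp add: lookup_part lookup_add)
  have part_homog: "part q = (if e = d then q else 0)" if "homog w e q" for e q
    using that by (auto intro!: poly_mapping_eqI simp: lookup_part homog_def in_keys_iff)
  have "q \<in> rep B UNIV" if "q \<in> ideal.span B" for q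
    using that
  proof (induction rule: ideal.span_induct_alt)
    case (step c b q)
    have "c * b \<in> rep B UNIV"
      by (induction c rule: mpoly_induct)
        (simp_all add: rep_zero distrib_right rep_plus rep_monom step.hyps)
    then show ?case using step.IH by (rule rep_plus)
  qed (simp add: rep_zero)
  moreover have "part q \<in> rep B {m. wdeg w m = d}" if "q \<in> rep B UNIV" for q
    using that
  proof (induction rule: rep.induct)
    case rep_zero
    show ?case using part_homog[OF homog_zero] rep.rep_zero by simp
  next
    case (rep_add q b t c)
    obtain e where e: "homog w e b" using hom rep_add.hyps by blast
    have prod: "homog w (wdeg w t + e) (single t c * b)"
      by (rule homog_mult[OF homog_single e]) simp
    have "part (single t c * b) \<in> rep B {m. wdeg w m = d}"
    proof (cases "b = 0 \<or> wdeg w t + e \<noteq> d")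
      case True
      then have "part (single t c * b) = 0"
        using part_homog[OF prod] part_homog[OF homog_zero] by auto
      then show ?thesis by (simp add: rep.rep_zero)
    next
      case False
      then have "wdeg w (LT \<sigma> b) = e" using e LT_in_keys by (auto simp: homog_def)
      then show ?thesis
        using False part_homog[OF prod] rep_add.hyps by (simp add: rep_monom wdeg_add)
    qed
    then show ?case by (simp add: part_add rep_plus rep_add.IH)
  qed
  ultimately have "part p \<in> rep B {m. wdeg w m = d}" using p(1) by blast
  then show ?thesis using part_homog[OF p(2)] by simp
qed

end

section \<open>The weighted-degree refinement of a term ordering\<close>

text \<open>
  Comparing degrees first turns the leading monomial into one of maximal degree. In this way
  the degree of a product can be read off from \<open>lookup_mult_max\<close>.
\<close>

definition weight_ordering :: "('v \<Rightarrow> nat) \<Rightarrow> 'v pp rel \<Rightarrow> 'v pp rel" where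
  "weight_ordering w \<sigma> = {(s, t). wdeg w s < wdeg w t \<or> wdeg w s = wdeg w t \<and> (s, t) \<in> \<sigma>}"

lemma (in term_order) term_order_weight: "term_order (weight_ordering w \<sigma>)"
proof
  have "linear_order (weight_ordering w \<sigma>)"
    unfolding linear_order_on_def partial_order_on_def preorder_on_def
  proof (intro conjI)
    show "refl (weight_ordering w \<sigma>)"
      by (auto simp: refl_on_def weight_ordering_def le_refl)
    show "trans (weight_ordering w \<sigma>)"
      by (rule transI) (auto simp: weight_ordering_def intro: le_trans)
    show "antisym (weight_ordering w \<sigma>)"
      by (rule antisymI) (auto simp: weight_ordering_def intro: le_antisym)
    show "total (weight_ordering w \<sigma>)"
      using le_total by (auto simp: total_on_def weight_ordering_def)
  qed simp_all
  moreover have "(0, t) \<in> weight_ordering w \<sigma>" for t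
    using zero_le by (auto simp: weight_ordering_def)
  moreover have "(s + u, t + u) \<in> weight_ordering w \<sigma>" if "(s, t) \<in> weight_ordering w \<sigma>" for s t u
    using that le_add[of s t u] by (auto simp: weight_ordering_def wdeg_add add.commute)
  ultimately show "term_ordering (weight_ordering w \<sigma>)"
    unfolding term_ordering_def by blast
qed

section \<open>The ideal of the algorithm\<close>

instance var :: (finite, finite) finite
proof
  have "v \<in> range T \<union> {H} \<union> range X" for v :: "('a, 'b) var"
    by (cases v) auto
  then have "(UNIV :: ('a, 'b) var set) \<subseteq> range T \<union> {H} \<union> range X" by blast
  then show "finite (UNIV :: ('a, 'b) var set)" by (rule finite_subset) simp
qed

lemma subst_homogenization:
  "\<chi> H = 1 \<Longrightarrow> subst \<chi> (homogenization p) = subst (\<lambda>j. \<chi> (T j)) p"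
  by (simp add: homogenization_def subst_sum subst_mult subst_pp_eval subst_power
      subst_def[of "\<lambda>j. \<chi> (T j)"])

lemma wdeg_le_total_degree: "m \<in> keys p \<Longrightarrow> wdeg (\<lambda>_. 1) m \<le> total_degree p"
  by (simp add: total_degree_def)

lemma homog_homogenization:
  assumes "\<And>j. w (T j) = 1" "w H = 1"
  shows "homog w (total_degree p) (homogenization p)"
  unfolding homogenization_def
proof (rule homog_sum)
  fix m assume m: "m \<in> keys p"
  have "homog w (0 + wdeg (\<lambda>_. 1) m + 1 * (total_degree p - wdeg (\<lambda>_. 1) m))
    (Const (lookup p m) * pp_eval (\<lambda>j. Var (T j)) m * Var H ^ (total_degree p - wdeg (\<lambda>_. 1) m))"
    by (intro homog_mult homog_power homog_Const homog_pp_eval homog_Var assms)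
  then show "homog w (total_degree p)
    (Const (lookup p m) * pp_eval (\<lambda>j. Var (T j)) m * Var H ^ (total_degree p - wdeg (\<lambda>_. 1) m))"
    using wdeg_le_total_degree[OF m] by simp
qed

lemma total_degree_pos:
  assumes "p \<notin> range Const"
  shows "0 < total_degree p"
proof (rule ccontr)
  assume "\<not> 0 < total_degree p"
  then have "m = 0" if "m \<in> keys p" for m
    using wdeg_le_total_degree[OF that] by (intro wdeg_eq_0D[of "\<lambda>_. 1"]) auto
  then have "p = Const (lookup p 0)"
    by (intro poly_mapping_eqI) (auto simp: Const_def lookup_single when_def in_keys_iff)
  then show False using assms by blast
qed

abbreviation dehomogenize ::
  "(('s, 'n) var, 'a::comm_ring_1) mpoly \<Rightarrow> (('s, 'n) var, 'a) mpoly" where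
  "dehomogenize \<equiv> subst (\<lambda>v. if v = H then 1 else Var v)"

locale elimTH =
  fixes f :: "'n::finite \<Rightarrow> ('s::finite, 'a::field) mpoly"
    and \<sigma> :: "('s, 'n) var pp rel"
  assumes nonconstant: "\<And>i. f i \<notin> range Const"
    and elim: "elimination_ordering TYPE('a) (range T) \<sigma>"
begin

sublocale term_order \<sigma>
  using elim by unfold_locales (simp add: elimination_ordering_def)

definition J :: "(('s, 'n) var, 'a) mpoly set" where
  "J = ideal.span (generators f)"

definition T_free :: "('s, 'n) var pp \<Rightarrow> bool" where
  "T_free m \<longleftrightarrow> keys m \<inter> range T = {}"

abbreviation w where "w \<equiv> grading f"

lemma w_pos: "0 < w v"
  by (cases v) (simp_all add: total_degree_pos nonconstant)

lemma vars_T_free: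
  fixes p :: "(('s, 'n) var, 'a) mpoly"
  assumes "p \<noteq> 0" "T_free (LT \<sigma> p)"
  shows "vars p \<inter> range T = {}"
  using elim assms unfolding elimination_ordering_def T_free_def by blast

lemma T_free_dvd: "pp_dvd s t \<Longrightarrow> T_free t \<Longrightarrow> T_free s"
proof -
  assume "pp_dvd s t"
  then have "keys s \<subseteq> keys t" by (auto simp: pp_dvd_def in_keys_iff lookup_add)
  then show "T_free t \<Longrightarrow> T_free s" unfolding T_free_def by blast
qed

lemma homog_generator:
  assumes "b \<in> generators f"
  shows "\<exists>e. homog w e b"
proof -
  obtain i where "b = Var (X i) - homogenization (f i)" using assms by (auto simp: generators_def)
  then have "homog w (total_degree (f i)) b"
    by (simp add: homog_diff homog_Var homog_homogenization)
  then show ?thesis by blast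
qed

text \<open>
  An elimination ordering can only give a generator a leading term without \<open>t\<^sub>j\<close> if no \<open>t\<^sub>j\<close> occurs
  in the generator. But setting \<open>h = 1\<close> and \<open>x = 0\<close> turns it into \<open>- f\<^sub>i\<close>, which is not constant.
\<close>

lemma generator_not_T_free:
  assumes "b \<in> generators f"
  shows "b \<noteq> 0" "\<not> T_free (LT \<sigma> b)"
proof -
  obtain i where b: "b = Var (X i) - homogenization (f i)" using assms by (auto simp: generators_def)
  define \<chi> :: "('s \<Rightarrow> ('s, 'a) mpoly) \<Rightarrow> ('s, 'n) var \<Rightarrow> ('s, 'a) mpoly"
    where "\<chi> \<phi> v = (case v of T j \<Rightarrow> \<phi> j | H \<Rightarrow> 1 | X i \<Rightarrow> 0)" for \<phi> v
  have \<chi>: "subst (\<chi> \<phi>) b = - subst \<phi> (f i)" for \<phi>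
    by (simp add: b subst_diff subst_homogenization \<chi>_def)
  then have "subst (\<chi> Var) b = - f i" by (simp add: subst_Var_id)
  moreover have "f i \<noteq> 0" using nonconstant[of i] Const_zero by (metis rangeI)
  ultimately show nz: "b \<noteq> 0" by auto
  show "\<not> T_free (LT \<sigma> b)"
  proof
    assume "T_free (LT \<sigma> b)"
    then have "subst (\<chi> Var) b = subst (\<chi> (\<lambda>_. 0)) b"
      using vars_T_free[OF nz] by (intro subst_cong) (auto simp: \<chi>_def split: var.split)
    then have "f i = subst (\<lambda>_. 0) (f i)" by (simp add: \<chi> subst_Var_id)
    also have "\<dots> = Const (lookup (f i) 0)"
    proof -
      have "pp_eval (\<lambda>_. 0 :: ('s, 'a) mpoly) m = (if m = 0 then 1 else 0)" for m :: "'s pp"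
      proof (cases "m = 0")
        case False
        then obtain v where "v \<in> keys m" by (metis ex_in_conv keys_eq_empty)
        then have "(\<Prod>v\<in>keys m. (0 :: ('s, 'a) mpoly) ^ lookup m v) = 0"
          by (intro prod_zero bexI[of _ v]) (simp_all add: in_keys_iff zero_power)
        then show ?thesis using False by (simp add: pp_eval_def)
      qed simp
      then show ?thesis
        by (simp add: subst_def if_distrib[of "(*) _"] in_keys_iff cong: if_cong)
    qed
    finally show False using nonconstant[of i] by blast
  qed
qed

lemma subst_J_eq_0:
  assumes "\<And>i. \<chi> (X i) = subst \<chi> (homogenization (f i))" "p \<in> J"
  shows "subst \<chi> p = 0"
  using assms(2) unfolding J_def
proof (induction rule: ideal.span_induct_alt)
  case (step c b p)
  then have "subst \<chi> b = 0" by (auto simp: generators_def subst_diff assms(1))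
  with step show ?case by (simp add: subst_add subst_mult)
qed simp

text \<open>
  Every \<open>x\<^sub>i\<close> is congruent to \<open>F\<^sub>i\<close> modulo \<open>J\<close>. So \<open>J\<close> contains the kernel of \<open>x\<^sub>i \<mapsto> F\<^sub>i\<close>.
\<close>

lemma diff_subst_in_J:
  "p - subst (\<lambda>v. case v of X i \<Rightarrow> homogenization (f i) | _ \<Rightarrow> Var v) p \<in> J"
proof -
  have "Var v - (case v of X i \<Rightarrow> homogenization (f i) | _ \<Rightarrow> Var v) \<in> J" for v
    unfolding J_def by (cases v) (auto simp: generators_def ideal.span_zero intro: ideal.span_base)
  then have "subst Var p - subst (\<lambda>v. case v of X i \<Rightarrow> homogenization (f i) | _ \<Rightarrow> Var v) p
    \<in> ideal.span (generators f)"
    unfolding J_def by (rule subst_congruent)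
  then show ?thesis
    by (simp add: J_def subst_Var_id)
qed

definition embed :: "('n, 'a) mpoly \<Rightarrow> (('s, 'n) var, 'a) mpoly" where
  "embed = subst (\<lambda>i. Var (X i))"

text \<open>
  On polynomials free of the \<open>t\<^sub>j\<close> this sets \<open>h = 1\<close>; the value chosen for \<open>t\<^sub>j\<close> is arbitrary.
\<close>

definition project :: "(('s, 'n) var, 'a) mpoly \<Rightarrow> ('n, 'a) mpoly" where
  "project = subst (\<lambda>v. case v of X i \<Rightarrow> Var i | H \<Rightarrow> 1 | T j \<Rightarrow> 0)"

lemma project_embed: "project (embed p) = p"
  by (simp add: project_def embed_def subst_subst subst_Var_id)

lemma subst_embed: "subst \<chi> (embed p) = subst (\<lambda>i. \<chi> (X i)) p"
  by (simp add: embed_def subst_subst)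

lemma embed_eq_0_iff: "embed p = 0 \<longleftrightarrow> p = 0"
  using project_embed[of p] by (auto simp: embed_def project_def)

lemma embed_project:
  assumes "G \<noteq> 0" "T_free (LT \<sigma> G)"
  shows "embed (project G) = dehomogenize G"
proof -
  have "embed (project G) = subst (\<lambda>v. embed (case v of X i \<Rightarrow> Var i | H \<Rightarrow> 1 | T j \<Rightarrow> 0)) G"
    by (simp add: embed_def project_def subst_subst)
  also have "\<dots> = dehomogenize G"
    using vars_T_free[OF assms] by (intro subst_cong) (auto simp: embed_def split: var.split)
  finally show ?thesis .
qed

lemma vars_embed: "vars (embed p) \<subseteq> range X"
  using vars_subst[of "\<lambda>i. Var (X i)" p] by (auto simp: embed_def vars_def Var_def)

text \<open>
  The homogenization \<open>G\<close> of an implicit relation to degree \<open>d\<close> lies in \<open>J\<close>. Substituting \<open>F\<^sub>i\<close>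
  for \<open>x\<^sub>i\<close> in it gives a homogeneous polynomial that vanishes at \<open>h = 1\<close>, hence is zero.
\<close>

lemma T_free_witness:
  assumes p: "p \<in> Implicit f" "p \<noteq> 0"
    and d: "\<And>k. k \<in> keys (embed p) \<Longrightarrow> wdeg w k \<le> d"
  shows "\<exists>G\<in>J. G \<noteq> 0 \<and> T_free (LT \<sigma> G) \<and> homog w d G"
proof -
  let ?p = "embed p"
  define G where "G = (\<Sum>m\<in>keys ?p. single (m + single H (d - wdeg w m)) (lookup ?p m))"
  have subst_G: "subst \<chi> G = subst \<chi> ?p"
    if "\<chi> H = 1" for \<chi> :: "('s, 'n) var \<Rightarrow> (('s, 'n) var, 'a) mpoly"
    unfolding G_def subst_sum subst_single pp_eval_add pp_eval_single that
    by (simp add: subst_def)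
  have "dehomogenize G = ?p"
    by (simp add: subst_G subst_embed) (simp add: embed_def)
  then have "G \<noteq> 0" using p(2) by (auto simp: embed_eq_0_iff)
  moreover have hom: "homog w d G"
    unfolding G_def by (intro homog_sum homog_single) (simp add: wdeg_add d)
  moreover have "T_free (LT \<sigma> G)"
  proof -
    have "LT \<sigma> G \<in> (\<Union>m\<in>keys ?p. keys (single (m + single H (d - wdeg w m)) (lookup ?p m)))"
      using LT_in_keys[OF \<open>G \<noteq> 0\<close>] unfolding G_def by (rule subsetD[OF keys_sum])
    then obtain m where m: "m \<in> keys ?p" "LT \<sigma> G = m + single H (d - wdeg w m)"
      by (auto split: if_splits)
    have "keys m \<subseteq> range X" using vars_embed[of p] m(1) by (auto simp: vars_def)
    then have "keys (LT \<sigma> G) \<subseteq> range X \<union> {H}"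
      using keys_add[of m "single H (d - wdeg w m)"] by (auto simp: m(2) split: if_splits)
    then show ?thesis by (auto simp: T_free_def)
  qed
  moreover have "G \<in> J"
  proof -
    define \<Phi> :: "('s, 'n) var \<Rightarrow> (('s, 'n) var, 'a) mpoly"
      where "\<Phi> v = (case v of X i \<Rightarrow> homogenization (f i) | _ \<Rightarrow> Var v)" for v
    have "homog w (w v) (\<Phi> v)" for v
      by (cases v) (simp_all add: \<Phi>_def homog_Var homog_homogenization)
    then have "homog w d (subst \<Phi> G)" using hom by (rule homog_subst)
    moreover have "dehomogenize (subst \<Phi> G) = 0"
    proof -
      have "dehomogenize (subst \<Phi> G) = subst (\<lambda>v. dehomogenize (\<Phi> v)) ?p"
        by (simp add: subst_subst subst_G \<Phi>_def)
      also have "\<dots> = subst (\<lambda>i. subst (\<lambda>j. Var (T j)) (f i)) p"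
        by (simp add: subst_embed \<Phi>_def subst_homogenization)
      also have "\<dots> = subst (\<lambda>j. Var (T j)) (subst f p)"
        by (simp add: subst_subst)
      also have "\<dots> = 0" using p(1) by (simp add: Implicit_def)
      finally show ?thesis .
    qed
    ultimately have "subst \<Phi> G = 0"
      using dehomogenization_eq_0D[of w d "subst \<Phi> G" H] by simp
    then show ?thesis using diff_subst_in_J[of G] by (simp add: \<Phi>_def[abs_def])
  qed
  ultimately show ?thesis by blast
qed

text \<open>
  The hypothesis on \<open>G\<close> is what the algorithm guarantees for the polynomial at which it exits.
\<close>

lemma minimal_degree_generates:
  assumes g0: "Implicit f = ideal.span {g0}" "Implicit f \<noteq> {0}"
    and G: "G \<in> J" "G \<noteq> 0" "T_free (LT \<sigma> G)" "homog w d G"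
    and minimal: "\<And>G' e. G' \<in> J \<Longrightarrow> G' \<noteq> 0 \<Longrightarrow> homog w e G' \<Longrightarrow> T_free (LT \<sigma> G') \<Longrightarrow> d \<le> e"
  shows "Implicit f = ideal.span {project G}"
proof -
  interpret \<tau>: term_order "weight_ordering w \<sigma>" by (rule term_order_weight)
  have max_wdeg: "wdeg w k \<le> wdeg w (LT (weight_ordering w \<sigma>) p)" if "k \<in> keys p"
    for k and p :: "(('s, 'n) var, 'a) mpoly"
    using \<tau>.keys_le_LT[OF that] by (auto simp: weight_ordering_def)
  define g where "g = project G"
  have embed_g: "embed g = dehomogenize G"
    unfolding g_def by (rule embed_project[OF G(2,3)])
  have g_nz: "embed g \<noteq> 0"
    using dehomogenization_eq_0D[OF G(4), of H] G(2) embed_g by auto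
  have "g0 \<noteq> 0" using g0 by (auto simp: ideal.span_singleton)
  have g0_in: "g0 \<in> Implicit f" unfolding g0(1) by (rule ideal.span_base) simp
  define d0 where "d0 = wdeg w (LT (weight_ordering w \<sigma>) (embed g0))"
  obtain G0 where G0: "G0 \<in> J" "G0 \<noteq> 0" "T_free (LT \<sigma> G0)" "homog w d0 G0"
    using T_free_witness[OF g0_in \<open>g0 \<noteq> 0\<close>, of d0] max_wdeg unfolding d0_def by blast
  \<comment> \<open>This bounds the degree of \<open>g = a * g0\<close> by that of \<open>g0\<close>, leaving degree zero for \<open>a\<close>.\<close>
  have d: "d \<le> d0" by (rule minimal[OF G0(1,2,4,3)])
  have "subst f g = 0"
  proof -
    define \<theta> where "\<theta> v = (case v of X i \<Rightarrow> f i | H \<Rightarrow> 1 | T j \<Rightarrow> Var j)" for v :: "('s, 'n) var"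
    have "subst f g = subst \<theta> (dehomogenize G)"
      by (simp add: \<theta>_def subst_embed flip: embed_g)
    also have "\<dots> = subst \<theta> G"
      unfolding subst_subst by (rule subst_cong) (simp add: \<theta>_def)
    also have "\<dots> = 0"
      by (rule subst_J_eq_0[OF _ G(1)]) (simp add: \<theta>_def subst_homogenization subst_Var_id)
    finally show ?thesis .
  qed
  then have "g \<in> Implicit f" by (simp add: Implicit_def)
  then have "g \<in> ideal.span {g0}" by (simp only: g0(1))
  then obtain a where a: "g = a * g0" by (auto simp: ideal.span_singleton)
  then have embed_a: "embed g = embed a * embed g0" by (simp add: embed_def subst_mult)
  let ?LT = "LT (weight_ordering w \<sigma>)"
  have nz: "embed a \<noteq> 0" "embed g0 \<noteq> 0" using g_nz embed_a by auto
  have "lookup (embed g) (?LT (embed a) + ?LT (embed g0))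
    = lookup (embed a) (?LT (embed a)) * lookup (embed g0) (?LT (embed g0))"
    unfolding embed_a by (rule \<tau>.lookup_mult_max) (rule \<tau>.keys_le_LT; assumption)+
  then have "?LT (embed a) + ?LT (embed g0) \<in> keys (embed g)"
    using \<tau>.LT_in_keys[OF nz(1)] \<tau>.LT_in_keys[OF nz(2)] by (simp add: in_keys_iff)
  then have "wdeg w (?LT (embed a) + ?LT (embed g0)) \<le> d"
    unfolding embed_g by (rule wdeg_dehomogenize[OF G(4)])
  then have "wdeg w (?LT (embed a)) = 0" using d by (simp add: wdeg_add d0_def)
  then have "k = 0" if "k \<in> keys (embed a)" for k
    using max_wdeg[OF that] w_pos by (intro wdeg_eq_0D[of w]) simp_all
  then have "embed a = Const (lookup (embed a) 0)"
    by (intro poly_mapping_eqI) (auto simp: Const_def lookup_single when_def in_keys_iff)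
  then have "a = Const (lookup (embed a) 0)"
    using project_embed[of a] by (metis project_def subst_Const)
  then obtain c where c: "a = Const c" by blast
  with a g_nz have "c \<noteq> 0" by (auto simp: embed_eq_0_iff)
  then have "g0 = Const (1 / c) * g"
    by (simp add: a c flip: mult.assoc Const_mult)
  have "ideal.span {g0} = ideal.span {g}"
  proof (rule ideal.span_eq[THEN iffD2], intro conjI)
    show "{g0} \<subseteq> ideal.span {g}" using \<open>g0 = _\<close> by (auto simp: ideal.span_singleton)
    show "{g} \<subseteq> ideal.span {g0}" using a by (auto simp: ideal.span_singleton)
  qed
  then show ?thesis using g0(1) by (simp add: g_def)
qed

end

context elimTH
begin

section \<open>The loop invariant\<close>

definition good_basis :: "(('s, 'n) var, 'a) mpoly set \<Rightarrow> bool" where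
  "good_basis GB \<longleftrightarrow> finite GB \<and> generators f \<subseteq> GB \<and>
    (\<forall>b\<in>GB. b \<noteq> 0 \<and> b \<in> J \<and> (\<exists>e. homog w e b) \<and> \<not> T_free (LT \<sigma> b))"

definition pairs :: "'r set \<Rightarrow> 'r set set" where
  "pairs GB = {{p, q} |p q. p \<in> GB \<and> q \<in> GB \<and> p \<noteq> q}"

text \<open>
  The monomials that the polynomials arising in the reduction of the S-polynomial of \<open>p\<close> and \<open>q\<close>
  can contain.
\<close>

definition below :: "(('s, 'n) var, 'a) mpoly \<Rightarrow> (('s, 'n) var, 'a) mpoly \<Rightarrow> ('s, 'n) var pp set" where
  "below p q = {m. wdeg w m = pair_degree w \<sigma> p q \<and> m \<sqsubset> pp_lcm (LT \<sigma> p) (LT \<sigma> q)}"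

text \<open>
  Outside the queue \<open>P\<close>, all pairs are resolved. While the pair of \<open>p\<close> and \<open>q\<close> is being reduced it is
  the only exception, and the queue holds no pair of lower degree. At the exit, this becomes the
  minimality of the degree of \<open>G\<close>.
\<close>

inductive invariant :: "(('s, 'n) var, 'a) mpoly state \<Rightarrow> bool" where
  invariant_LoopI: "good_basis GB \<Longrightarrow> P \<subseteq> pairs GB
    \<Longrightarrow> (\<And>p q. p \<in> GB \<Longrightarrow> q \<in> GB \<Longrightarrow> p \<noteq> q \<Longrightarrow> {p, q} \<notin> P \<Longrightarrow> resolved w GB p q)
    \<Longrightarrow> invariant (Loop GB P)"
| invariant_ReduceI: "good_basis GB \<Longrightarrow> P \<subseteq> pairs GB \<Longrightarrow> r \<in> J \<Longrightarrow> p \<in> GB \<Longrightarrow> q \<in> GB \<Longrightarrow> p \<noteq> q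
    \<Longrightarrow> keys r \<subseteq> below p q \<Longrightarrow> spoly \<sigma> p q - r \<in> rep GB (below p q)
    \<Longrightarrow> (\<And>p' q'. {p', q'} \<in> P \<Longrightarrow> pair_degree w \<sigma> p q \<le> pair_degree w \<sigma> p' q')
    \<Longrightarrow> (\<And>p' q'. p' \<in> GB \<Longrightarrow> q' \<in> GB \<Longrightarrow> p' \<noteq> q' \<Longrightarrow> {p', q'} \<notin> P \<Longrightarrow> {p', q'} \<noteq> {p, q}
      \<Longrightarrow> resolved w GB p' q')
    \<Longrightarrow> invariant (Reduce GB P r)"
| invariant_ExitI: "G \<in> J \<Longrightarrow> G \<noteq> 0 \<Longrightarrow> T_free (LT \<sigma> G) \<Longrightarrow> homog w d G
    \<Longrightarrow> (\<And>G' e. G' \<in> J \<Longrightarrow> G' \<noteq> 0 \<Longrightarrow> homog w e G' \<Longrightarrow> T_free (LT \<sigma> G') \<Longrightarrow> d \<le> e)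
    \<Longrightarrow> invariant (Exit G)"

inductive_cases invariant_LoopE: "invariant (Loop GB P)"
inductive_cases invariant_ReduceE: "invariant (Reduce GB P r)"
inductive_cases invariant_ExitE: "invariant (Exit G)"

lemma resolved_iff: "resolved w GB p q \<longleftrightarrow> spoly \<sigma> p q \<in> rep GB (below p q)"
  by (simp add: resolved_def below_def)

lemma good_basisD:
  assumes "good_basis GB"
  shows "0 \<notin> GB" "finite GB"
    and "b \<in> GB \<Longrightarrow> b \<noteq> 0" "b \<in> GB \<Longrightarrow> b \<in> J" "b \<in> GB \<Longrightarrow> \<exists>e. homog w e b"
    and "b \<in> GB \<Longrightarrow> \<not> T_free (LT \<sigma> b)"
  using assms by (auto simp: good_basis_def)

text \<open>
  All leading terms of the basis involve some \<open>t\<^sub>j\<close>, and so do their multiples.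
\<close>

lemma not_T_free_of_resolved:
  assumes GB: "good_basis GB"
    and res: "\<And>p q. p \<in> GB \<Longrightarrow> q \<in> GB \<Longrightarrow> p \<noteq> q \<Longrightarrow> pair_degree w \<sigma> p q \<le> e \<Longrightarrow> resolved w GB p q"
    and G: "G \<in> J" "G \<noteq> 0" "homog w e G"
  shows "\<not> T_free (LT \<sigma> G)"
proof -
  have "generators f \<subseteq> GB" using GB by (simp add: good_basis_def)
  then have "G \<in> ideal.span GB" using G(1) ideal.span_mono unfolding J_def by blast
  then have "G \<in> rep GB {m. wdeg w m = e}"
    using homog_span_rep[OF good_basisD(5)[OF GB]] G(3) by blast
  then obtain b where "b \<in> GB" "pp_dvd (LT \<sigma> b) (LT \<sigma> G)"
    using truncated_buchberger_criterion[OF good_basisD(1)[OF GB] res _ G(2)] by blast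
  then show ?thesis using T_free_dvd good_basisD(6)[OF GB] by blast
qed

lemma pairs_distinct: "{p, q} \<in> pairs GB \<Longrightarrow> p \<in> GB \<and> q \<in> GB \<and> p \<noteq> q"
  by (auto simp: pairs_def doubleton_eq_iff)

lemma spoly_in_J: "p \<in> J \<Longrightarrow> q \<in> J \<Longrightarrow> spoly \<sigma> p q \<in> J"
  unfolding spoly_def Let_def J_def by (intro ideal.span_diff ideal.span_scale)

lemma keys_spoly:
  assumes "good_basis GB" "p \<in> GB" "q \<in> GB"
  shows "keys (spoly \<sigma> p q) \<subseteq> below p q"
proof
  fix k assume k: "k \<in> keys (spoly \<sigma> p q)"
  note B = good_basisD[OF assms(1)]
  obtain d e where "homog w d p" "homog w e q" using B(5) assms(2,3) by blast
  then have "homog w (pair_degree w \<sigma> p q) (spoly \<sigma> p q)"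
    using B(3) assms(2,3) by (intro homog_spoly) blast+
  then show "k \<in> below p q"
    using k spoly_keys_lt[OF B(3)[OF assms(2)] B(3)[OF assms(3)] k]
    by (simp add: below_def homog_def)
qed

lemma invariant_init: "invariant (elimTH_init f)"
proof -
  have "finite (generators f)" by (simp add: generators_def)
  then have "good_basis (generators f)"
    using generator_not_T_free homog_generator
    by (auto simp: good_basis_def J_def intro: ideal.span_base)
  then show ?thesis
    unfolding elimTH_init_def by (rule invariant_LoopI) (auto simp: pairs_def)
qed

lemma invariant_reduce:
  assumes "invariant (Reduce GB P r)" "red \<sigma> GB r r'"
  shows "invariant (Reduce GB P r')"
proof -
  from assms(1) obtain p q where GB: "good_basis GB" "P \<subseteq> pairs GB" "r \<in> J" and pq: "p \<in> GB" "q \<in> GB" "p \<noteq> q"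
    and r: "keys r \<subseteq> below p q" "spoly \<sigma> p q - r \<in> rep GB (below p q)"
    and P: "\<And>p' q'. {p', q'} \<in> P \<Longrightarrow> pair_degree w \<sigma> p q \<le> pair_degree w \<sigma> p' q'"
      "\<And>p' q'. p' \<in> GB \<Longrightarrow> q' \<in> GB \<Longrightarrow> p' \<noteq> q' \<Longrightarrow> {p', q'} \<notin> P \<Longrightarrow> {p', q'} \<noteq> {p, q}
      \<Longrightarrow> resolved w GB p' q'"
    by (rule invariant_ReduceE) blast
  from assms(2) obtain b m where b: "b \<in> GB" "b \<noteq> 0" "pp_dvd (LT \<sigma> b) m" and m: "m \<in> keys r"
    and r': "r' = r - single (m - LT \<sigma> b) (lookup r m / LC \<sigma> b) * b"
    unfolding red_def by blast
  define s where "s = single (m - LT \<sigma> b) (lookup r m / LC \<sigma> b) * b"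
  have m_below: "m \<in> below p q" using m r(1) by blast
  have s_rep: "s \<in> rep GB (below p q)"
    unfolding s_def using b m_below by (intro rep_monom) (simp_all add: pp_dvd_minus_add)
  have "keys s \<subseteq> below p q"
  proof
    fix k assume k: "k \<in> keys s"
    obtain e where e: "homog w e b" using good_basisD(5)[OF GB(1) b(1)] by blast
    have "wdeg w (LT \<sigma> b) = e" using e LT_in_keys[OF b(2)] by (simp add: homog_def)
    then have "homog w (wdeg w (m - LT \<sigma> b + LT \<sigma> b)) s"
      unfolding s_def wdeg_add using homog_mult[OF homog_single[OF refl] e] by simp
    then have "wdeg w k = wdeg w m"
      using k unfolding pp_dvd_minus_add[OF b(3)] by (simp add: homog_def)
    moreover have "k \<sqsubseteq> m" using monom_mult_cancel_LT(2)[OF b(2,3)] k by (simp add: s_def)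
    ultimately show "k \<in> below p q"
      using m_below le_lt_trans unfolding below_def by auto
  qed
  then have "keys r' \<subseteq> below p q"
    using keys_minus_subset[of r s] r(1) unfolding r' s_def by blast
  moreover have "spoly \<sigma> p q - r' \<in> rep GB (below p q)"
    using rep_plus[OF r(2) s_rep] by (simp add: r' s_def algebra_simps)
  moreover have "r' \<in> J"
    using GB(3) good_basisD(4)[OF GB(1) b(1)] unfolding r' J_def
    by (intro ideal.span_diff ideal.span_scale)
  ultimately show ?thesis using GB(1,2) pq P by (intro invariant_ReduceI[of GB P r' p q])
qed

lemma invariant_discard:
  assumes "invariant (Reduce GB P 0)"
  shows "invariant (Loop GB P)"
proof -
  from assms obtain p q where GB: "good_basis GB" "P \<subseteq> pairs GB"
    and pq: "spoly \<sigma> p q - 0 \<in> rep GB (below p q)"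
    and P: "\<And>p' q'. p' \<in> GB \<Longrightarrow> q' \<in> GB \<Longrightarrow> p' \<noteq> q' \<Longrightarrow> {p', q'} \<notin> P \<Longrightarrow> {p', q'} \<noteq> {p, q}
      \<Longrightarrow> resolved w GB p' q'"
    by (rule invariant_ReduceE) blast
  have "resolved w GB p q" using pq by (simp add: resolved_iff)
  then have "resolved w GB p' q'" if "{p', q'} = {p, q}" for p' q'
    using that by (auto simp: doubleton_eq_iff resolved_commute)
  then show ?thesis using GB P by (intro invariant_LoopI) blast+
qed

text \<open>
  The remainder \<open>r\<close> is now itself a basis element, so adding it back to the representation of
  \<open>spoly p q - r\<close> resolves the pair. Irreducibility makes \<open>r\<close> new, so that the new pairs have two
  distinct members.
\<close>

lemma invariant_add:
  assumes invariant: "invariant (Reduce GB P r)" and r0: "r \<noteq> 0" and irred: "\<nexists>r'. red \<sigma> GB r r'"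
    and T: "\<not> T_free (LT \<sigma> r)"
  shows "invariant (Loop (insert r GB) (P \<union> {{g, r} |g. g \<in> GB}))"
proof -
  from invariant obtain p q where GB: "good_basis GB" "P \<subseteq> pairs GB" "r \<in> J" and pq: "p \<in> GB" "q \<in> GB" "p \<noteq> q"
    and r: "keys r \<subseteq> below p q" "spoly \<sigma> p q - r \<in> rep GB (below p q)"
    and P: "\<And>p' q'. p' \<in> GB \<Longrightarrow> q' \<in> GB \<Longrightarrow> p' \<noteq> q' \<Longrightarrow> {p', q'} \<notin> P \<Longrightarrow> {p', q'} \<noteq> {p, q}
      \<Longrightarrow> resolved w GB p' q'"
    by (rule invariant_ReduceE) blast
  let ?GB = "insert r GB" and ?P = "P \<union> {{g, r} |g. g \<in> GB}"
  have r_new: "r \<notin> GB"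
    using irreducible_LT[OF irred r0 _ r0] pp_dvd_add[of 0 "LT \<sigma> r"] by auto
  have "homog w (pair_degree w \<sigma> p q) r" using r(1) by (auto simp: homog_def below_def)
  then have good: "good_basis ?GB"
    using GB r0 T unfolding good_basis_def by blast
  have "spoly \<sigma> p q - r + single 0 1 * r \<in> rep ?GB (below p q)"
  proof (rule rep_add)
    show "spoly \<sigma> p q - r \<in> rep ?GB (below p q)" using r(2) by (rule rep_mono) auto
    show "0 + LT \<sigma> r \<in> below p q" using LT_in_keys[OF r0] r(1) by auto
  qed simp
  then have "resolved w ?GB p q" by (simp add: resolved_iff)
  then have pq_res: "resolved w ?GB p' q'" if "{p', q'} = {p, q}" for p' q'
    using that by (auto simp: doubleton_eq_iff resolved_commute)
  have "resolved w ?GB p' q'"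
    if p'q': "p' \<in> ?GB" "q' \<in> ?GB" "p' \<noteq> q'" "{p', q'} \<notin> ?P" for p' q'
  proof -
    have "p' \<in> GB" "q' \<in> GB" using p'q' by (auto simp: insert_commute)
    moreover have "{p', q'} \<notin> P" using p'q'(4) by blast
    ultimately show ?thesis
      using P p'q'(3) pq_res resolved_mono[of w GB p' q' ?GB] by (cases "{p', q'} = {p, q}") auto
  qed
  moreover have "?P \<subseteq> pairs ?GB"
    using GB(2) r_new unfolding pairs_def by blast
  ultimately show ?thesis using good by (intro invariant_LoopI) blast+
qed

text \<open>
  A homogeneous element of degree below that of the current pair is covered by resolved pairs only:
  the queue and the current pair have too large a degree.
\<close>

lemma invariant_exit:
  assumes invariant: "invariant (Reduce GB P r)" and r0: "r \<noteq> 0" and T: "T_free (LT \<sigma> r)"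
  shows "invariant (Exit r)"
proof -
  from invariant obtain p q where GB: "good_basis GB" "r \<in> J"
    and r: "keys r \<subseteq> below p q"
    and P: "\<And>p' q'. {p', q'} \<in> P \<Longrightarrow> pair_degree w \<sigma> p q \<le> pair_degree w \<sigma> p' q'"
      "\<And>p' q'. p' \<in> GB \<Longrightarrow> q' \<in> GB \<Longrightarrow> p' \<noteq> q' \<Longrightarrow> {p', q'} \<notin> P \<Longrightarrow> {p', q'} \<noteq> {p, q}
      \<Longrightarrow> resolved w GB p' q'"
    by (rule invariant_ReduceE) blast
  let ?d = "pair_degree w \<sigma> p q"
  have "homog w ?d r" using r by (auto simp: homog_def below_def)
  moreover have "?d \<le> e" if G: "G \<in> J" "G \<noteq> 0" "homog w e G" "T_free (LT \<sigma> G)" for G e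
  proof (rule ccontr)
    assume less: "\<not> ?d \<le> e"
    have "\<not> T_free (LT \<sigma> G)"
    proof (rule not_T_free_of_resolved[OF GB(1) _ G(1-3)])
      fix p' q' assume p'q': "p' \<in> GB" "q' \<in> GB" "p' \<noteq> q'" "pair_degree w \<sigma> p' q' \<le> e"
      then have "{p', q'} \<notin> P" using P(1) less by fastforce
      moreover have "{p', q'} \<noteq> {p, q}"
        using p'q'(4) less by (auto simp: doubleton_eq_iff pair_degree_commute)
      ultimately show "resolved w GB p' q'" using P(2) p'q' by blast
    qed
    then show False using G(4) by blast
  qed
  ultimately show ?thesis using GB(2) r0 T by (intro invariant_ExitI[of r ?d])
qed

lemma invariant_step:
  assumes "elimTH_step f \<sigma> st st'" "invariant st"
  shows "invariant st'"
  using assms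
proof cases
  case (select p q P GB)
  from assms(2)[unfolded select(1)] have GB: "good_basis GB" "P \<subseteq> pairs GB"
    and res: "\<And>p q. p \<in> GB \<Longrightarrow> q \<in> GB \<Longrightarrow> p \<noteq> q \<Longrightarrow> {p, q} \<notin> P \<Longrightarrow> resolved w GB p q"
    by (auto elim: invariant_LoopE)
  have pq: "p \<in> GB" "q \<in> GB" "p \<noteq> q" using pairs_distinct[of p q GB] select(3) GB(2) by blast+
  show ?thesis
    unfolding select(2)
  proof (rule invariant_ReduceI[OF GB(1) _ _ pq keys_spoly[OF GB(1) pq(1,2)]])
    show "P - {{p, q}} \<subseteq> pairs GB" using GB(2) by blast
    show "spoly \<sigma> p q \<in> J" using spoly_in_J good_basisD(4)[OF GB(1)] pq by blast
    show "spoly \<sigma> p q - spoly \<sigma> p q \<in> rep GB (below p q)" by (simp add: rep_zero)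
  qed (use select(4) res in blast)+
next
  case (reduce GB r r' P)
  then show ?thesis using assms(2) invariant_reduce by simp
next
  case (discard GB P)
  then show ?thesis using assms(2) invariant_discard by simp
next
  case (add r GB P)
  then show ?thesis using assms(2) invariant_add by (simp add: T_free_def)
next
  case (exit r GB P)
  then show ?thesis using assms(2) invariant_exit by (simp add: T_free_def)
qed

lemma invariant_reachable: "(elimTH_step f \<sigma>)\<^sup>*\<^sup>* (elimTH_init f) st \<Longrightarrow> invariant st"
  by (induction rule: rtranclp_induct) (simp_all add: invariant_init invariant_step)

section \<open>Termination and correctness\<close>

definition leading_ideal :: "(('s, 'n) var, 'a) mpoly set \<Rightarrow> ('s, 'n) var pp set" where
  "leading_ideal GB = {m. \<exists>b\<in>GB. pp_dvd (LT \<sigma> b) m}"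

text \<open>
  Compared lexicographically: adding a polynomial enlarges the leading ideal, selecting a pair
  shortens the queue, discarding ends the reduction phase, and reducing lowers the multiset of
  monomials. The rank of \<open>Exit\<close> is a dummy, since no step leaves that state.
\<close>

fun rank :: "(('s, 'n) var, 'a) mpoly state
    \<Rightarrow> ('s, 'n) var pp set \<times> nat \<times> nat \<times> ('s, 'n) var pp multiset" where
  "rank (Loop GB P) = (leading_ideal GB, card P, 0, {#})"
| "rank (Reduce GB P r) = (leading_ideal GB, card P, 1, mset_set (keys r))"
| "rank (Exit G) = ({}, 0, 0, {#})"

definition rank_less ::
  "(('s, 'n) var pp set \<times> nat \<times> nat \<times> ('s, 'n) var pp multiset) rel" where
  "rank_less = {(A, B). B \<subset> A \<and> (\<forall>s\<in>A. \<forall>t. pp_dvd s t \<longrightarrow> t \<in> A)}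
     <*lex*> less_than <*lex*> less_than <*lex*> mult {(s, t). s \<sqsubset> t}"

lemma wf_rank_less: "wf rank_less"
  unfolding rank_less_def
  by (intro wf_lex_prod wf_up_closed_supset wf_less_than wf_mult wf_lt)

lemma rank_decreases:
  assumes "elimTH_step f \<sigma> st st'" "invariant st" "\<nexists>G. st' = Exit G"
  shows "(rank st', rank st) \<in> rank_less"
  using assms(1)
proof cases
  case (select p q P GB)
  have "good_basis GB" "P \<subseteq> pairs GB" using assms(2) select(1) by (auto elim: invariant_LoopE)
  moreover have "pairs GB \<subseteq> Pow GB" by (auto simp: pairs_def)
  ultimately have "finite P" using good_basisD(2) by (meson finite_Pow_iff finite_subset)
  then have "card (P - {{p, q}}) < card P" using select(3) by (rule card_Diff1_less)
  then show ?thesis by (simp add: select rank_less_def)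
next
  case (reduce GB r r' P)
  then show ?thesis using red_decreases[of GB r r'] by (simp add: rank_less_def)
next
  case (add r GB P)
  let ?A = "leading_ideal (insert r GB)"
  have "LT \<sigma> r \<in> ?A" using pp_dvd_add[of 0 "LT \<sigma> r"] by (auto simp: leading_ideal_def)
  moreover have "LT \<sigma> r \<notin> leading_ideal GB"
  proof -
    have "good_basis GB" using assms(2) add(1) by (auto elim: invariant_ReduceE)
    then show ?thesis
      using irreducible_LT[OF add(4,3)] good_basisD(3) by (auto simp: leading_ideal_def)
  qed
  moreover have "leading_ideal GB \<subseteq> ?A" by (auto simp: leading_ideal_def)
  ultimately have "leading_ideal GB \<subset> ?A" by blast
  moreover have "\<forall>s\<in>?A. \<forall>t. pp_dvd s t \<longrightarrow> t \<in> ?A"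
    unfolding leading_ideal_def by (auto intro: pp_dvd_trans)
  ultimately show ?thesis by (simp add: add rank_less_def)
qed (use assms(3) in \<open>simp_all add: rank_less_def\<close>)

lemma no_infinite_run:
  "\<nexists>run. run 0 = elimTH_init f \<and> (\<forall>k. elimTH_step f \<sigma> (run k) (run (Suc k)))"
proof
  assume "\<exists>run. run 0 = elimTH_init f \<and> (\<forall>k. elimTH_step f \<sigma> (run k) (run (Suc k)))"
  then obtain run where run: "run 0 = elimTH_init f" "\<And>k. elimTH_step f \<sigma> (run k) (run (Suc k))"
    by blast
  have invariant: "invariant (run k)" for k
    by (induction k) (simp_all add: run(1) invariant_init invariant_step[OF run(2)])
  have "\<nexists>G. run (Suc k) = Exit G" for k
    using run(2)[of "Suc k"] by (auto elim: elimTH_step.cases)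
  then have "(rank (run (Suc k)), rank (run k)) \<in> rank_less" for k
    using rank_decreases[OF run(2) invariant] by blast
  then have "\<exists>r. \<forall>k. (r (Suc k), r k) \<in> rank_less" by (intro exI[of _ "\<lambda>k. rank (run k)"]) simp
  then show False using wf_rank_less unfolding wf_iff_no_infinite_down_chain by blast
qed

text \<open>
  A state without successor that is not an exit is a loop with empty queue. All pairs would be
  resolved, and every nonzero homogeneous element of \<open>J\<close> would have a leading term with some \<open>t\<^sub>j\<close>,
  against the homogenization of a nonzero implicit relation.
\<close>

lemma final_state:
  assumes invariant: "invariant st" and final: "\<nexists>st'. elimTH_step f \<sigma> st st'" and nonzero: "Implicit f \<noteq> {0}"
  shows "\<exists>G. st = Exit G"
proof (cases st)
  case (Loop GB P)
  have GB: "good_basis GB" "P \<subseteq> pairs GB"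
    and res: "\<And>p q. p \<in> GB \<Longrightarrow> q \<in> GB \<Longrightarrow> p \<noteq> q \<Longrightarrow> {p, q} \<notin> P \<Longrightarrow> resolved w GB p q"
    using invariant unfolding Loop by (auto elim: invariant_LoopE)
  have "P = {}"
  proof (rule ccontr)
    assume "P \<noteq> {}"
    then obtain p0 q0 where "{p0, q0} \<in> P" using GB(2) unfolding pairs_def by blast
    then have "\<exists>x. (\<lambda>(p, q). {p, q} \<in> P) x \<and>
        (\<forall>y. (\<lambda>(p, q). {p, q} \<in> P) y \<longrightarrow> (\<lambda>(p, q). pair_degree w \<sigma> p q) x \<le> (\<lambda>(p, q). pair_degree w \<sigma> p q) y)"
      by (intro ex_has_least_nat[of _ "(p0, q0)"]) simp
    then obtain p q where "{p, q} \<in> P"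
      "\<forall>p' q'. {p', q'} \<in> P \<longrightarrow> pair_degree w \<sigma> p q \<le> pair_degree w \<sigma> p' q'" by auto
    then show False using final elimTH_step.select unfolding Loop by blast
  qed
  have "0 \<in> Implicit f" by (simp add: Implicit_def)
  then obtain p where p: "p \<in> Implicit f" "p \<noteq> 0" using nonzero by blast
  define d where "d = Max (wdeg w ` keys (embed p))"
  have "wdeg w k \<le> d" if "k \<in> keys (embed p)" for k
    using that by (simp add: d_def)
  from T_free_witness[OF p this] obtain G where
    "G \<in> J" "G \<noteq> 0" "T_free (LT \<sigma> G)" "homog w d G" by blast
  then show ?thesis
    using not_T_free_of_resolved[OF GB(1), of d G] res \<open>P = {}\<close> by blast
next
  case (Reduce GB P r)
  consider "r = 0" | r' where "red \<sigma> GB r r'"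
    | "r \<noteq> 0" "\<nexists>r'. red \<sigma> GB r r'" "keys (LT \<sigma> r) \<inter> range T \<noteq> {}"
    | "r \<noteq> 0" "\<nexists>r'. red \<sigma> GB r r'" "keys (LT \<sigma> r) \<inter> range T = {}"
    by blast
  then have "\<exists>st'. elimTH_step f \<sigma> st st'"
    unfolding Reduce by cases (blast intro: elimTH_step.intros)+
  then show ?thesis using final by blast
qed blast

end

theorem mainTheorem3:
  fixes f :: "'n::finite \<Rightarrow> ('s::finite, 'a::field) mpoly"
    and \<sigma> :: "('s, 'n) var pp rel"
  assumes nonconstant: "\<And>i. f i \<notin> range Const"
    and principal: "\<exists>g. Implicit f = ideal.span {g}"
    and nonzero: "Implicit f \<noteq> {0}"
    and elim: "elimination_ordering TYPE('a) (range T) \<sigma>"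
  shows "(\<nexists>run. run 0 = elimTH_init f \<and> (\<forall>k. elimTH_step f \<sigma> (run k) (run (Suc k)))) \<and>
    (\<forall>st. (elimTH_step f \<sigma>)\<^sup>*\<^sup>* (elimTH_init f) st \<and> (\<nexists>st'. elimTH_step f \<sigma> st st') \<longrightarrow>
      (\<exists>G g. st = Exit G \<and> elimTH_output G g \<and> Implicit f = ideal.span {g}))"
proof (intro conjI allI impI; (elim conjE)?)
  interpret elimTH f \<sigma> by unfold_locales (fact nonconstant, fact elim)
  show "\<nexists>run. run 0 = elimTH_init f \<and> (\<forall>k. elimTH_step f \<sigma> (run k) (run (Suc k)))"
    by (rule no_infinite_run)
  fix st assume reach: "(elimTH_step f \<sigma>)\<^sup>*\<^sup>* (elimTH_init f) st" and final: "\<nexists>st'. elimTH_step f \<sigma> st st'"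
  have "invariant st" using reach by (rule invariant_reachable)
  with final nonzero obtain G where st: "st = Exit G" using final_state by blast
  with \<open>invariant st\<close> obtain d where G: "G \<in> J" "G \<noteq> 0" "T_free (LT \<sigma> G)" "homog w d G"
    and minimal: "\<And>G' e. G' \<in> J \<Longrightarrow> G' \<noteq> 0 \<Longrightarrow> homog w e G' \<Longrightarrow> T_free (LT \<sigma> G') \<Longrightarrow> d \<le> e"
    by (auto elim: invariant_ExitE)
  obtain g0 where "Implicit f = ideal.span {g0}" using principal by blast
  then have "Implicit f = ideal.span {project G}"
    using nonzero G minimal by (rule minimal_degree_generates)
  moreover have "elimTH_output G (project G)"
    using embed_project[OF G(2,3)] by (simp add: elimTH_output_def embed_def)
  ultimately show "\<exists>G g. st = Exit G \<and> elimTH_output G g \<and> Implicit f = ideal.span {g}"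
    using st by blast
qed

end
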